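(* Let $z$ be a fixed complex number with $\Re(z) > 0$, let $\beta>0$ be a constant, and let $m = m(n)$, $n=1,2,\ldots$, be a sequence of positive integers such that $m(n) \sim \beta\ln n$ as $n\to\infty$. Let $\alpha$ be the unique solution of the equation $$\alpha - \beta\ln \alpha = \beta - \beta \ln\beta + 1$$ in the interval $(\beta, \infty)$. Then $$\mathbb{E}\left[\frac{\Gamma\left(D_{m,n}+z\right)}{\left(D_{m,n}-1\right)!}\right] = \mathbb{E}\left[\Delta_{m,n}^z\right] \sim \alpha^z n^z (\ln n)^z \sim \left(\frac{\alpha}{\beta}\right)^z n^z m^z, \qquad n \to \infty,$$ where $m=m(n)$.
   Context: Coupon collector setting: $n$ equally likely coupons are sampled independently with replacement (each trial yields coupon $j$ with probability $1/n$, $j=1,\dots,n$). For positive integers $m,n$, $D_{m,n}$ denotes the number of trials needed until all $n$ coupons have been detected at least $m$ times each. The variable $\Delta_{m,n}$ is the Poissonized version: the trials occur at the event times of a Poisson process $N(t)$, $t\ge 0$, of rate $1$, which is independent of the sequence of coupons sampled, and $\Delta_{m,n}$ is the time at which all $n$ coupons have been detected at least $m$ times. Equivalently $\Delta_{m,n} = \sum_{k=1}^{D_{m,n}} U_k$, where $U_1,U_2,\ldots$ are independent exponential random variables with parameter $1$ (the interarrival times), independent of $D_{m,n}$. Also $\Delta_{m,n}=\max_{1\le j\le n}T_j$, where $T_1,\dots,T_n$ are independent Erlang variables with parameters $m$ and $1/n$ ($T_j$ being the time of the $m$-th detection of coupon $j$). $\Gamma(\cdot)$ is the Gamma function; complex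 powers of a positive real $x$ are $x^z = e^{z\ln x}$ with real logarithm; $A(n)\sim B(n)$ means $A(n)/B(n)\to 1$ as $n\to\infty$. *)

theory Defs
  imports "HOL-Probability.Probability"
begin

text \<open>
  Trials are numbered from 0: \<open>X k \<omega>\<close> is the coupon drawn in the \<open>(k+1)\<close>-st trial, and \<open>U k \<omega>\<close> is the
  time between the \<open>k\<close>-th trial (time 0 if \<open>k = 0\<close>) and the \<open>(k+1)\<close>-st.
  The Poisson process of rate 1 is given through its interarrival times.
\<close>

locale coupon_collector = prob_space M
  for M :: "'a measure" and n :: nat
    and X :: "nat \<Rightarrow> 'a \<Rightarrow> nat" and U :: "nat \<Rightarrow> 'a \<Rightarrow> real" +
  assumes n_pos: "n \<ge> 1"
    and coupons_indep: "indep_vars (\<lambda>_. count_space UNIV) X UNIV"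
    and coupons_uniform: "\<And>k j. j \<in> {1..n} \<Longrightarrow> prob {\<omega> \<in> space M. X k \<omega> = j} = 1 / real n"
    and interarrivals_indep: "indep_vars (\<lambda>_. borel) U UNIV"
    and interarrivals_exponential: "\<And>k. distributed M lborel (U k) (exponential_density 1)"
    and coupons_interarrivals_indep:
      "indep_set
         (sets (vimage_algebra (space M) (\<lambda>\<omega> k. X k \<omega>) (PiM UNIV (\<lambda>_. count_space UNIV))))
         (sets (vimage_algebra (space M) (\<lambda>\<omega> k. U k \<omega>) (PiM UNIV (\<lambda>_. borel))))"

definition all_detected :: "nat \<Rightarrow> nat \<Rightarrow> (nat \<Rightarrow> 'a \<Rightarrow> nat) \<Rightarrow> nat \<Rightarrow> 'a \<Rightarrow> bool" where
  "all_detected m n X N \<omega> \<longleftrightarrow> (\<forall>j\<in>{1..n}. m \<le> card {k. k < N \<and> X k \<omega> = j})"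

text \<open>On the null event that the collection is never completed, \<open>coupon_D\<close> is an irrelevant constant.\<close>

definition coupon_D :: "nat \<Rightarrow> nat \<Rightarrow> (nat \<Rightarrow> 'a \<Rightarrow> nat) \<Rightarrow> 'a \<Rightarrow> nat" where
  "coupon_D m n X \<omega> = (LEAST N. all_detected m n X N \<omega>)"

definition arrival_time :: "(nat \<Rightarrow> 'a \<Rightarrow> real) \<Rightarrow> nat \<Rightarrow> 'a \<Rightarrow> real" where
  "arrival_time U k \<omega> = (\<Sum>i<k. U i \<omega>)"

definition poisson_count :: "(nat \<Rightarrow> 'a \<Rightarrow> real) \<Rightarrow> real \<Rightarrow> 'a \<Rightarrow> nat" where
  "poisson_count U t \<omega> = card {k. 1 \<le> k \<and> arrival_time U k \<omega> \<le> t}"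

definition coupon_Delta ::
    "nat \<Rightarrow> nat \<Rightarrow> (nat \<Rightarrow> 'a \<Rightarrow> nat) \<Rightarrow> (nat \<Rightarrow> 'a \<Rightarrow> real) \<Rightarrow> 'a \<Rightarrow> real" where
  "coupon_Delta m n X U \<omega> = Inf {t. 0 \<le> t \<and> all_detected m n X (poisson_count U t \<omega>) \<omega>}"

text \<open>
  Almost surely all interarrival times are positive and the collection is eventually completed;
  on such paths \<open>coupon_Delta\<close> is the sum of the first \<open>coupon_D\<close> interarrival times.
\<close>

lemma coupon_Delta_eq_sum:
  assumes pos: "\<And>k. 0 < U k \<omega>" and fin: "\<exists>N. all_detected m n X N \<omega>"
    and m: "1 \<le> m" and n: "1 \<le> n"
  shows "coupon_Delta m n X U \<omega> = (\<Sum>k<coupon_D m n X \<omega>. U k \<omega>)"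
proof -
  let ?S = "\<lambda>k. arrival_time U k \<omega>" and ?D = "coupon_D m n X \<omega>"
  have mono: "strict_mono ?S"
    by (rule strict_monoI_Suc) (simp add: arrival_time_def pos)
  have D: "all_detected m n X ?D \<omega>"
    using fin unfolding coupon_D_def by (rule LeastI_ex)
  have nn: "0 \<le> ?S ?D"
    unfolding arrival_time_def by (intro sum_nonneg) (simp add: pos less_imp_le)
  have "{k. 1 \<le> k \<and> ?S k \<le> ?S ?D} = {1..?D}"
    using strict_mono_less_eq[OF mono] by auto
  hence 1: "poisson_count U (?S ?D) \<omega> = ?D" by (simp add: poisson_count_def)
  have 2: "?S ?D \<le> t" if t: "all_detected m n X (poisson_count U t \<omega>) \<omega>" for t
  proof (rule ccontr)
    assume "\<not> ?S ?D \<le> t"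
    hence "{k. 1 \<le> k \<and> ?S k \<le> t} \<subseteq> {1..<?D}"
      using strict_mono_less[OF mono] by fastforce
    hence "poisson_count U t \<omega> \<le> card {1..<?D}"
      unfolding poisson_count_def by (intro card_mono) auto
    moreover have "?D \<noteq> 0"
    proof
      assume "?D = 0"
      with D n have "m \<le> 0" unfolding all_detected_def by (auto dest!: bspec[where x = 1])
      with m show False by simp
    qed
    ultimately have "poisson_count U t \<omega> < ?D" by simp
    thus False using t not_less_Least unfolding coupon_D_def by blast
  qed
  have "coupon_Delta m n X U \<omega> = ?S ?D"
    unfolding coupon_Delta_def by (rule cInf_eq_minimum) (use D nn 1 2 in auto)
  thus ?thesis by (simp add: arrival_time_def)
qed

end

theory Submission
  imports Defs
begin

text \<open>
  The law of \<open>\<Delta>\<close> is computed exactly: \<open>P(\<Delta> \<le> t) = (1 - q)\<^sup>n\<close>, where \<open>q\<close> is the probability that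
  a Poisson variable of mean \<open>t / n\<close> is less than \<open>m\<close>. It follows from \<open>\<Delta> = S\<^sub>D\<close>, with \<open>S\<^sub>d\<close> Erlang and
  independent of \<open>D\<close>, and from the exponential generating function
  \<open>(\<Sum>k\<ge>m. x\<^sup>k / k!)\<^sup>n\<close> of the number of words over \<open>n\<close> letters using each letter at least \<open>m\<close> times.
  Fubini and the moment \<open>E S\<^sub>d\<^sup>z = \<Gamma>(d + z) / (d - 1)!\<close> give the equality of the two expectations.

  For \<open>t = s n ln n\<close>, Stirling-type bounds yield \<open>n q = n\<close> to the power \<open>- \<phi>(s) + o(1)\<close>, where
  \<open>\<phi>(s) = s - \<beta> ln s - (\<beta> - \<beta> ln \<beta> + 1)\<close> vanishes at \<open>\<alpha>\<close>. Hence \<open>\<Delta> / (n ln n)\<close> tends to \<open>\<alpha>\<close> in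
  probability. The Chernoff bound \<open>q \<le> 2\<^sup>m e\<close> to the power \<open>- t / (2 n)\<close> controls the tails, so the
  moments converge as well.
\<close>

section \<open>Words using each letter at least \<open>m\<close> times\<close>

text \<open>Words of length \<open>N\<close> are the case \<open>S = {..<N}\<close>; extensional
  functions keep the set finite. Other \<open>S\<close> occur because the induction removes
  arbitrary sets of positions.\<close>

definition covering_maps :: "nat \<Rightarrow> 'a set \<Rightarrow> 'b set \<Rightarrow> ('a \<Rightarrow> 'b) set" where
  "covering_maps m S J = {f \<in> S \<rightarrow>\<^sub>E J. \<forall>j\<in>J. m \<le> card {i \<in> S. f i = j}}"

text \<open>Recursion over the letters: one letter takes \<open>k\<close> of the \<open>N\<close>
  positions and the other \<open>c\<close> letters share the rest. Such a binomial convolution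
  becomes a product of exponential generating functions.\<close>

fun covering_number :: "nat \<Rightarrow> nat \<Rightarrow> nat \<Rightarrow> nat" where
  "covering_number m 0 N = (if N = 0 then 1 else 0)"
| "covering_number m (Suc c) N =
     (\<Sum>k\<le>N. if m \<le> k then (N choose k) * covering_number m c (N - k) else 0)"

lemma finite_covering_maps: "finite S \<Longrightarrow> finite J \<Longrightarrow> finite (covering_maps m S J)"
  by (rule finite_subset[of _ "S \<rightarrow>\<^sub>E J"]) (auto simp: covering_maps_def finite_PiE)

text \<open>A word splits into the positions of the letter \<open>j\<close> and the word left on the
  other positions. As \<open>j \<notin> J\<close>, the fibres of the other letters do not change, so
  the multiplicity condition splits as well.\<close>

lemma bij_betw_covering_maps_insert:
  assumes "j \<notin> J"
  shows "bij_betw (\<lambda>f. ({i \<in> S. f i = j}, restrict f (S - {i \<in> S. f i = j})))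
    (covering_maps m S (insert j J))
    (SIGMA A : {A. A \<subseteq> S \<and> m \<le> card A}. covering_maps m (S - A) J)"
proof (rule bij_betw_byWitness[where f' = "\<lambda>(A, g) i. if i \<in> A then j else g i"], goal_cases)
  case 1
  show ?case
    by (auto simp: covering_maps_def fun_eq_iff PiE_def extensional_def)
next
  case 2
  show ?case
    using assms
    by (auto simp: covering_maps_def fun_eq_iff PiE_def extensional_def split: if_splits)
next
  case 3
  show ?case
  proof (rule image_subsetI)
    fix f assume f: "f \<in> covering_maps m S (insert j J)"
    let ?A = "{i \<in> S. f i = j}"
    have "m \<le> card {i \<in> S - ?A. restrict f (S - ?A) i = k}" if "k \<in> J" for k
    proof -
      have "{i \<in> S - ?A. restrict f (S - ?A) i = k} = {i \<in> S. f i = k}"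
        using that assms by auto
      thus ?thesis using f that by (auto simp: covering_maps_def)
    qed
    thus "(?A, restrict f (S - ?A)) \<in> (SIGMA A : {A. A \<subseteq> S \<and> m \<le> card A}. covering_maps m (S - A) J)"
      using f by (auto simp: covering_maps_def PiE_def Pi_def)
  qed
next
  case 4
  show ?case
  proof (rule image_subsetI, clarify)
    fix A g assume A: "A \<subseteq> S" "m \<le> card A" and g: "g \<in> covering_maps m (S - A) J"
    let ?f = "\<lambda>i. if i \<in> A then j else g i"
    have "{i \<in> S. ?f i = j} = A"
      using A g assms by (auto simp: covering_maps_def PiE_def Pi_def)
    moreover have "{i \<in> S. ?f i = k} = {i \<in> S - A. g i = k}" if "k \<in> J" for k
      using that assms by auto
    ultimately show "?f \<in> covering_maps m S (insert j J)"
      using A g by (auto simp: covering_maps_def PiE_def Pi_def extensional_def)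
  qed
qed

text \<open>Induction over the letters: the bijection splits off one letter, and grouping its
  position sets \<open>A\<close> by their size \<open>k\<close> yields the binomial coefficients of
  the recursion.\<close>

lemma card_covering_maps:
  fixes S :: "'a set" and J :: "'b set"
  assumes "finite J" "finite S"
  shows "card (covering_maps m S J) = covering_number m (card J) (card S)"
  using assms
proof (induction J arbitrary: S rule: finite_induct)
  case empty
  have "covering_maps m S ({} :: 'b set) = (if S = {} then {\<lambda>_. undefined} else {})"
    by (auto simp: covering_maps_def PiE_def Pi_def extensional_def)
  thus ?case by (cases "S = {}") (use empty in simp_all)
next
  case (insert j J)
  let ?c = "covering_number m (card J)" and ?N = "card S"
  let ?P = "{A. A \<subseteq> S \<and> m \<le> card A}"
  have fin: "finite ?P" using insert.prems by (auto intro: finite_subset[of _ "Pow S"])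
  have "card (covering_maps m S (insert j J))
      = card (SIGMA A : ?P. covering_maps m (S - A) J)"
    by (rule bij_betw_same_card[OF bij_betw_covering_maps_insert]) (fact insert.hyps)
  also have "\<dots> = (\<Sum>A\<in>?P. card (covering_maps m (S - A) J))"
    using fin insert by (intro card_SigmaI) (auto intro!: finite_covering_maps)
  also have "\<dots> = (\<Sum>A\<in>?P. ?c (?N - card A))"
    using insert.prems by (intro sum.cong) (auto simp: insert.IH card_Diff_subset finite_subset)
  also have "\<dots> = (\<Sum>k\<le>?N. \<Sum>A\<in>{A. A \<in> ?P \<and> card A = k}. ?c (?N - card A))"
    using insert.prems fin by (intro sum.group[symmetric]) (auto intro: card_mono)
  also have "\<dots> = (\<Sum>k\<le>?N. if m \<le> k then (?N choose k) * ?c (?N - k) else 0)"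
  proof (intro sum.cong refl)
    fix k assume "k \<in> {..?N}"
    have "(\<Sum>A\<in>{A. A \<in> ?P \<and> card A = k}. ?c (?N - card A))
        = card {A. A \<in> ?P \<and> card A = k} * ?c (?N - k)"
      by simp
    also have "card {A. A \<in> ?P \<and> card A = k} = (if m \<le> k then ?N choose k else 0)"
    proof -
      have eq: "{A. A \<in> ?P \<and> card A = k} = (if m \<le> k then {A. A \<subseteq> S \<and> card A = k} else {})"
        by auto
      show ?thesis unfolding eq using insert.prems by (simp add: n_subsets)
    qed
    finally show "(\<Sum>A\<in>{A. A \<in> ?P \<and> card A = k}. ?c (?N - card A))
        = (if m \<le> k then (?N choose k) * ?c (?N - k) else 0)" by (simp split: if_splits)
  qed
  finally show ?case using insert.hyps by simp
qed

lemma summable_exp_tail: "summable (\<lambda>k. if m \<le> k then x ^ k / fact k else 0 :: real)"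
proof (rule summable_comparison_test')
  show "summable (\<lambda>k. \<bar>x\<bar> ^ k / fact k)"
    using summable_exp[of "\<bar>x\<bar>"] by (simp add: field_simps)
  show "norm (if m \<le> k then x ^ k / fact k else 0) \<le> \<bar>x\<bar> ^ k / fact k" if "k \<ge> 0" for k
    by (simp add: power_abs)
qed

text \<open>Each letter contributes one factor: in the Cauchy product,
  \<open>(N choose k) / fact N = 1 / (fact k * fact (N - k))\<close> reproduces the recursion. The
  terms are nonnegative, which gives the absolute summability that the product requires.\<close>

lemma covering_number_egf:
  fixes x :: real
  assumes "0 \<le> x"
  shows "(\<lambda>N. real (covering_number m c N) * x ^ N / fact N) sums
    (\<Sum>k. if m \<le> k then x ^ k / fact k else 0) ^ c"
proof (induction c)
  case 0
  have "(\<lambda>N. real (covering_number m 0 N) * x ^ N / fact N) = (\<lambda>N. if N = 0 then 1 else 0)"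
    by auto
  thus ?case using sums_single[of 0 "\<lambda>_. 1 :: real"] by simp
next
  case (Suc c)
  let ?a = "\<lambda>k. if m \<le> k then x ^ k / fact k else 0"
  let ?b = "\<lambda>N. real (covering_number m c N) * x ^ N / fact N"
  have a: "summable (\<lambda>k. norm (?a k))"
    using summable_exp_tail[of m x] by (rule summable_cong[THEN iffD1, rotated]) (use assms in simp)
  have b: "summable (\<lambda>k. norm (?b k))"
    using sums_summable[OF Suc] by (rule summable_cong[THEN iffD1, rotated]) (use assms in simp)
  have "(\<Sum>k\<le>N. ?a k * ?b (N - k)) = real (covering_number m (Suc c) N) * x ^ N / fact N" for N
  proof -
    have "?a k * ?b (N - k) = (if m \<le> k then real (N choose k) * real (covering_number m c (N - k)) else 0)
        * (x ^ N / fact N)" if "k \<le> N" for k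
      using that by (simp add: binomial_fact power_add[symmetric] field_simps)
    hence "(\<Sum>k\<le>N. ?a k * ?b (N - k)) = (\<Sum>k\<le>N. (if m \<le> k then
        real (N choose k) * real (covering_number m c (N - k)) else 0) * (x ^ N / fact N))"
      by (intro sum.cong) auto
    also have "\<dots> = real (covering_number m (Suc c) N) * (x ^ N / fact N)"
      unfolding covering_number.simps of_nat_sum
      by (subst sum_distrib_right) (intro sum.cong, auto)
    finally show ?thesis by simp
  qed
  with Cauchy_product_sums[OF a b] sums_unique[OF Suc] show ?case by simp
qed

section \<open>Measurability of the collection times\<close>

lemma measurable_all_detected:
  assumes [measurable]: "\<And>k. X k \<in> measurable M (count_space UNIV)"
  shows "Measurable.pred M (all_detected m n X N)"
  unfolding all_detected_def by measurable

lemma measurable_coupon_D: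
  assumes [measurable]: "\<And>k. X k \<in> measurable M (count_space UNIV)"
  shows "coupon_D m n X \<in> measurable M (count_space UNIV)"
proof -
  note measurable_all_detected[OF assms, measurable]
  show ?thesis unfolding coupon_D_def[abs_def] by measurable
qed

lemma all_detected_mono:
  assumes "all_detected m n X N \<omega>" "N \<le> N'"
  shows "all_detected m n X N' \<omega>"
  unfolding all_detected_def
proof
  fix j assume "j \<in> {1..n}"
  hence "m \<le> card {k. k < N \<and> X k \<omega> = j}" using assms by (auto simp: all_detected_def)
  also have "\<dots> \<le> card {k. k < N' \<and> X k \<omega> = j}" using assms by (intro card_mono) auto
  finally show "m \<le> card {k. k < N' \<and> X k \<omega> = j}" .
qed

lemma not_all_detected_0: "m \<ge> 1 \<Longrightarrow> n \<ge> 1 \<Longrightarrow> \<not> all_detected m n X 0 \<omega>"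
  by (auto simp: all_detected_def dest!: bspec[where x = 1])

lemma all_detected_iff_coupon_D_le:
  assumes "\<exists>N. all_detected m n X N \<omega>"
  shows "all_detected m n X N \<omega> \<longleftrightarrow> coupon_D m n X \<omega> \<le> N"
proof
  show "coupon_D m n X \<omega> \<le> N" if "all_detected m n X N \<omega>"
    unfolding coupon_D_def using that by (rule Least_le)
  show "all_detected m n X N \<omega>" if "coupon_D m n X \<omega> \<le> N"
    using LeastI_ex[OF assms] that unfolding coupon_D_def by (rule all_detected_mono)
qed

text \<open>
  On null paths infinitely many arrival times may lie below some \<open>t\<close>, and then \<open>poisson_count\<close>
  vanishes at \<open>t\<close>. Measurability must hold there too: whenever some time completes the collection,
  so does the last arrival time before it.
\<close>

lemma complete_at_arrival_time:
  assumes "m \<ge> 1" "n \<ge> 1" "0 \<le> t" and t: "all_detected m n X (poisson_count U t \<omega>) \<omega>"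
  obtains k where "max 0 (arrival_time U k \<omega>) \<le> t"
    "all_detected m n X (poisson_count U (max 0 (arrival_time U k \<omega>)) \<omega>) \<omega>"
proof -
  let ?S = "\<lambda>k. arrival_time U k \<omega>"
  let ?K = "{k. 1 \<le> k \<and> ?S k \<le> t}"
  \<comment> \<open>An infinite \<open>?K\<close> also has cardinality 0, so this yields finiteness
    together with nonemptiness.\<close>
  have "card ?K \<noteq> 0"
  proof
    assume "card ?K = 0"
    thus False using t not_all_detected_0[OF assms(1,2), of X \<omega>]
      unfolding poisson_count_def by simp
  qed
  hence K: "finite ?K" "?K \<noteq> {}" by (auto simp: card_eq_0_iff)
  have "Max (?S ` ?K) \<in> ?S ` ?K" using K by (intro Max_in) auto
  then obtain k where k0: "k \<in> ?K" "?S k = Max (?S ` ?K)" by auto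
  hence k: "k \<in> ?K" "\<And>k'. k' \<in> ?K \<Longrightarrow> ?S k' \<le> ?S k"
    using K by (auto intro!: Max_ge)
  have "{k'. 1 \<le> k' \<and> ?S k' \<le> max 0 (?S k)} = ?K"
    using k assms(3) by fastforce
  hence "poisson_count U (max 0 (?S k)) \<omega> = poisson_count U t \<omega>"
    by (simp add: poisson_count_def)
  with t k assms(3) show ?thesis by (intro that[of k]) auto
qed

text \<open>The infimum over all real \<open>t\<close> can be tested at the countably many times
  \<open>max 0 (arrival_time U k \<omega>)\<close>, by
  \<open>complete_at_arrival_time\<close>.\<close>

lemma measurable_coupon_Delta:
  assumes X [measurable]: "\<And>k. X k \<in> measurable M (count_space UNIV)"
    and U [measurable]: "\<And>k. U k \<in> borel_measurable M" and "m \<ge> 1" "n \<ge> 1"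
  shows "coupon_Delta m n X U \<in> borel_measurable M"
proof -
  \<comment> \<open>Truncated at 0, since arrival times may be negative on null paths while the
    infimum ranges over \<open>0 \<le> t\<close>.\<close>
  define T where "T k \<omega> = max 0 (arrival_time U k \<omega>)" for k \<omega>
  define B where "B k \<omega> = all_detected m n X (poisson_count U (T k \<omega>) \<omega>) \<omega>" for k \<omega>
  have [measurable]: "arrival_time U k \<in> borel_measurable M" for k
    unfolding arrival_time_def[abs_def] by measurable
  have [measurable]: "T k \<in> borel_measurable M" for k
    unfolding T_def[abs_def] by measurable
  note measurable_all_detected[OF X, measurable]
  have [measurable]: "(\<lambda>\<omega>. poisson_count U (T k \<omega>) \<omega>) \<in> measurable M (count_space UNIV)" for k
    unfolding poisson_count_def by measurable
  have "B k = (\<lambda>\<omega>. \<exists>N. poisson_count U (T k \<omega>) \<omega> = N \<and> all_detected m n X N \<omega>)" for k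
    by (auto simp: B_def)
  hence [measurable]: "Measurable.pred M (B k)" for k by simp
  \<comment> \<open>On paths that no time completes, the infimum is the constant
    \<open>Inf {}\<close>; carrying this case along makes the equivalence hold on every
    path.\<close>
  have "coupon_Delta m n X U \<omega> < c \<longleftrightarrow>
      (\<exists>k. B k \<omega> \<and> T k \<omega> < c) \<or> ((\<forall>k. \<not> B k \<omega>) \<and> Inf ({} :: real set) < c)" for c \<omega>
  proof -
    let ?A = "{t. 0 \<le> t \<and> all_detected m n X (poisson_count U t \<omega>) \<omega>}"
    have T: "T k \<omega> \<in> ?A" if "B k \<omega>" for k using that by (auto simp: B_def T_def)
    have A: "\<exists>k. B k \<omega> \<and> T k \<omega> \<le> t" if "t \<in> ?A" for t
      using that complete_at_arrival_time[OF assms(3,4), of t X U \<omega>] unfolding B_def T_def by blast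
    show ?thesis
    proof (cases "?A = {}")
      case True
      moreover have "\<not> B k \<omega>" for k using T[of k] True by blast
      ultimately show ?thesis unfolding coupon_Delta_def by (subst True) simp
    next
      case False
      hence "Inf ?A < c \<longleftrightarrow> (\<exists>t\<in>?A. t < c)"
        by (intro cInf_less_iff) (auto intro: bdd_belowI[of _ 0])
      moreover have "(\<exists>t\<in>?A. t < c) \<longleftrightarrow> (\<exists>k. B k \<omega> \<and> T k \<omega> < c)"
        using T A by (meson le_less_trans)
      moreover have "\<not> (\<forall>k. \<not> B k \<omega>)" using False A by blast
      ultimately show ?thesis unfolding coupon_Delta_def by blast
    qed
  qed
  thus ?thesis unfolding borel_measurable_iff_less by simp
qed

section \<open>Coupon sequences as random words\<close>

context coupon_collector
begin

lemma measurable_X [measurable]: "X k \<in> measurable M (count_space UNIV)"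
  using coupons_indep by (auto simp: indep_vars_def)

lemma measurable_U [measurable]: "U k \<in> borel_measurable M"
  using interarrivals_indep by (auto simp: indep_vars_def)

lemmas measurable_all_detected_X [measurable] = measurable_all_detected[of X, OF measurable_X]
lemmas measurable_coupon_D_X [measurable] = measurable_coupon_D[of X, OF measurable_X]

lemma AE_U_pos: "AE \<omega> in M. \<forall>k. 0 < U k \<omega>"
  unfolding AE_all_countable
proof
  fix k
  have "\<P>(\<omega> in M. 0 < U k \<omega>) = 1"
    using exponential_distributedD_gt[OF interarrivals_exponential[of k], of 0] by simp
  thus "AE \<omega> in M. 0 < U k \<omega>" by (subst (asm) prob_Collect_eq_1) auto
qed

text \<open>The \<open>n\<close> coupons already carry total probability 1, so other values of
  \<open>X k\<close> are confined to a null event.\<close>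

lemma AE_X_range: "AE \<omega> in M. \<forall>k. X k \<omega> \<in> {1..n}"
  unfolding AE_all_countable
proof
  fix k
  have "prob {\<omega> \<in> space M. X k \<omega> \<in> {1..n}} = prob (\<Union>j\<in>{1..n}. {\<omega> \<in> space M. X k \<omega> = j})"
    by (intro arg_cong[where f = prob]) auto
  also have "\<dots> = (\<Sum>j\<in>{1..n}. prob {\<omega> \<in> space M. X k \<omega> = j})"
    by (intro finite_measure_finite_Union) (auto simp: disjoint_family_on_def)
  also have "\<dots> = 1" using n_pos by (simp add: coupons_uniform)
  finally show "AE \<omega> in M. X k \<omega> \<in> {1..n}" by (subst (asm) prob_Collect_eq_1) auto
qed

lemma prob_X_word:
  assumes "f \<in> {..<N} \<rightarrow>\<^sub>E {1..n}"
  shows "prob {\<omega> \<in> space M. \<forall>i<N. X i \<omega> = f i} = 1 / real n ^ N"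
\<comment> \<open>\<open>N = 0\<close> is separate: independence is applied to a nonempty index set,
  and an empty intersection would be \<open>UNIV\<close> instead of \<open>space M\<close>.\<close>
proof (cases "N = 0")
  case True
  thus ?thesis by (simp add: prob_space)
next
  case False
  have "{\<omega> \<in> space M. \<forall>i<N. X i \<omega> = f i} = (\<Inter>i\<in>{..<N}. X i -` {f i} \<inter> space M)"
    using False by auto
  also have "prob \<dots> = (\<Prod>i<N. prob (X i -` {f i} \<inter> space M))"
    using False by (intro indep_varsD[OF coupons_indep]) auto
  also have "\<dots> = (\<Prod>i<N. 1 / real n)"
  proof (intro prod.cong refl)
    fix i assume "i \<in> {..<N}"
    with assms have "f i \<in> {1..n}" by (rule PiE_mem)
    moreover have "X i -` {f i} \<inter> space M = {\<omega> \<in> space M. X i \<omega> = f i}" by auto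
    ultimately show "prob (X i -` {f i} \<inter> space M) = 1 / real n"
      using coupons_uniform[of "f i" i] by simp
  qed
  finally show ?thesis by (simp add: power_divide)
qed

text \<open>Off the null event that a coupon leaves \<open>{1..n}\<close>, completion within
  \<open>N\<close> trials means that the word drawn is a covering word. These events are disjoint
  and have probability \<open>1 / real n ^ N\<close> each.\<close>

lemma prob_all_detected:
  "prob {\<omega> \<in> space M. all_detected m n X N \<omega>} = real (covering_number m n N) / real n ^ N"
proof -
  let ?C = "covering_maps m {..<N} {1..n}"
  have C: "finite ?C" by (intro finite_covering_maps) auto
  have ev: "{\<omega> \<in> space M. \<forall>i<N. X i \<omega> = f i} \<in> events" for f by measurable
  have "prob {\<omega> \<in> space M. all_detected m n X N \<omega>}
      = prob (\<Union>f\<in>?C. {\<omega> \<in> space M. \<forall>i<N. X i \<omega> = f i})"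
  proof (rule measure_eq_AE)
    show "AE \<omega> in M. \<omega> \<in> {\<omega> \<in> space M. all_detected m n X N \<omega>} \<longleftrightarrow>
        \<omega> \<in> (\<Union>f\<in>?C. {\<omega> \<in> space M. \<forall>i<N. X i \<omega> = f i})"
      using AE_X_range
    proof eventually_elim
      case (elim \<omega>)
      have "all_detected m n X N \<omega> \<longleftrightarrow> (\<exists>f\<in>?C. \<forall>i<N. X i \<omega> = f i)"
      proof
        assume "all_detected m n X N \<omega>"
        moreover have "{i \<in> {..<N}. restrict (\<lambda>i. X i \<omega>) {..<N} i = j} = {i. i < N \<and> X i \<omega> = j}" for j
          by auto
        ultimately have "restrict (\<lambda>i. X i \<omega>) {..<N} \<in> ?C"
          using elim by (auto simp: covering_maps_def all_detected_def)
        thus "\<exists>f\<in>?C. \<forall>i<N. X i \<omega> = f i" by (rule bexI[rotated]) auto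
      next
        assume "\<exists>f\<in>?C. \<forall>i<N. X i \<omega> = f i"
        then obtain f where f: "f \<in> ?C" "\<And>i. i < N \<Longrightarrow> X i \<omega> = f i" by blast
        have "{i. i < N \<and> X i \<omega> = j} = {i \<in> {..<N}. f i = j}" for j using f(2) by auto
        thus "all_detected m n X N \<omega>"
          using f(1) by (auto simp: covering_maps_def all_detected_def)
      qed
      thus ?case by auto
    qed
    show "(\<Union>f\<in>?C. {\<omega> \<in> space M. \<forall>i<N. X i \<omega> = f i}) \<in> events"
      using C ev by (intro sets.finite_UN) blast+
  qed measurable
  also have "\<dots> = (\<Sum>f\<in>?C. prob {\<omega> \<in> space M. \<forall>i<N. X i \<omega> = f i})"
  proof (intro finite_measure_finite_Union)
    show "disjoint_family_on (\<lambda>f. {\<omega> \<in> space M. \<forall>i<N. X i \<omega> = f i}) ?C"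
    proof (unfold disjoint_family_on_def, intro ballI impI)
      fix f g assume fg: "f \<in> ?C" "g \<in> ?C" "f \<noteq> g"
      hence "\<exists>i<N. f i \<noteq> g i"
        unfolding covering_maps_def by (metis (no_types, lifting) PiE_ext lessThan_iff mem_Collect_eq)
      thus "{\<omega> \<in> space M. \<forall>i<N. X i \<omega> = f i} \<inter> {\<omega> \<in> space M. \<forall>i<N. X i \<omega> = g i} = {}" by auto
    qed
    show "finite ?C" by (fact C)
    show "(\<lambda>f. {\<omega> \<in> space M. \<forall>i<N. X i \<omega> = f i}) ` ?C \<subseteq> events"
      using ev by blast
  qed
  also have "\<dots> = (\<Sum>f\<in>?C. 1 / real n ^ N)"
    by (intro sum.cong refl prob_X_word) (auto simp: covering_maps_def)
  finally show ?thesis by (simp add: card_covering_maps)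
qed

end

section \<open>The law of the completion time\<close>

text \<open>The probability that a Poisson variable of mean \<open>x\<close> is less than
  \<open>m\<close>; for \<open>m \<ge> 1\<close>, equally that a sum of \<open>m\<close> independent
  standard exponential variables exceeds \<open>x\<close>.\<close>

definition poisson_lt :: "nat \<Rightarrow> real \<Rightarrow> real" where
  "poisson_lt m x = exp (- x) * (\<Sum>k<m. x ^ k / fact k)"

lemma suminf_exp_tail:
  fixes x :: real
  shows "(\<Sum>k. if m \<le> k then x ^ k / fact k else 0) = exp x * (1 - poisson_lt m x)"
proof -
  have e: "(\<lambda>k. x ^ k / fact k) sums exp x"
    using exp_converges[of x] by (simp add: field_simps)
  have "(\<lambda>k. if k \<in> {..<m} then x ^ k / fact k else 0) sums (\<Sum>k<m. x ^ k / fact k)"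
    by (rule sums_If_finite_set) simp
  from sums_diff[OF e this]
  have "(\<lambda>k. x ^ k / fact k - (if k \<in> {..<m} then x ^ k / fact k else 0)) sums (exp x - (\<Sum>k<m. x ^ k / fact k))" .
  also have "(\<lambda>k. x ^ k / fact k - (if k \<in> {..<m} then x ^ k / fact k else 0))
      = (\<lambda>k. if m \<le> k then x ^ k / fact k else 0)" by auto
  finally have "(\<Sum>k. if m \<le> k then x ^ k / fact k else 0) = exp x - (\<Sum>k<m. x ^ k / fact k)"
    by (rule sums_unique[symmetric])
  also have "\<dots> = exp x * (1 - poisson_lt m x)"
    by (simp add: poisson_lt_def right_diff_distrib exp_minus field_simps)
  finally show ?thesis .
qed

lemma poisson_lt_nonneg: "0 \<le> x \<Longrightarrow> 0 \<le> poisson_lt m x"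
  by (auto simp: poisson_lt_def intro!: mult_nonneg_nonneg sum_nonneg)

lemma poisson_lt_le_1:
  assumes "0 \<le> x"
  shows "poisson_lt m x \<le> 1"
proof -
  have "0 \<le> (\<Sum>k. if m \<le> k then x ^ k / fact k else 0)"
    by (rule suminf_nonneg[OF summable_exp_tail]) (use assms in simp)
  thus ?thesis by (simp add: suminf_exp_tail zero_le_mult_iff)
qed

lemma poisson_lt_tendsto_0: "(poisson_lt m \<longlongrightarrow> 0) at_top"
proof -
  have "((\<lambda>x::real. \<Sum>k<m. (x ^ k / exp x) / fact k) \<longlongrightarrow> (\<Sum>k<m. 0 / fact k)) at_top"
  proof (rule tendsto_sum)
    fix k
    have "((\<lambda>x::real. x ^ k / exp x) \<longlongrightarrow> 0) at_top" by (rule tendsto_power_div_exp_0)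
    thus "((\<lambda>x::real. x ^ k / exp x / fact k) \<longlongrightarrow> 0 / fact k) at_top"
      by (rule tendsto_divide) auto
  qed
  also have "(\<lambda>x. \<Sum>k<m. (x ^ k / exp x) / fact k) = poisson_lt m"
    by (auto simp: poisson_lt_def exp_minus field_simps sum_distrib_left fun_eq_iff intro!: sum.cong)
  finally show ?thesis by simp
qed

text \<open>On the negative axis the logarithm is \<open>ln \<bar>x\<bar> + pi * \<i>\<close>, and
  at 0 the power is 0 by convention, so a case formula in measurable functions covers all real
  \<open>x\<close>.\<close>

lemma borel_measurable_of_real_powr [measurable]:
  "(\<lambda>x::real. complex_of_real x powr z) \<in> borel_measurable borel"
proof -
  have "(\<lambda>x::real. complex_of_real x powr z) = (\<lambda>x. if x = 0 then 0 else
      exp (z * (of_real (ln \<bar>x\<bar>) + (if x < 0 then pi else 0) * \<i>)))"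
    by (auto simp: powr_def Ln_of_real' fun_eq_iff)
  thus ?thesis by simp
qed

text \<open>For positive \<open>x\<close> the density is
  \<open>x ^ (d - 1) * exp (- x) / fact (d - 1)\<close>, so multiplying by the power gives the
  integrand of \<open>Gamma (of_nat d + z)\<close> up to the factorial.\<close>

lemma integral_erlang_powr:
  assumes "0 < Re z" "d \<ge> 1"
  shows "(\<integral>x. erlang_density (d - 1) 1 x *\<^sub>R complex_of_real x powr z \<partial>lborel)
    = Gamma (of_nat d + z) / fact (d - 1)"
proof -
  let ?w = "of_nat d + z" and ?c = "1 / fact (d - 1) :: complex"
  let ?g = "\<lambda>t. complex_of_real t powr (?w - 1) / of_real (exp t)"
  have w: "0 < Re ?w" using assms by simp
  note ai = absolutely_integrable_Gamma_integral'[OF w]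
  have "(\<integral>x. erlang_density (d - 1) 1 x *\<^sub>R complex_of_real x powr z \<partial>lborel)
      = (\<integral>x. ?c * (indicator {0<..} x *\<^sub>R ?g x) \<partial>lborel)"
  proof (rule Bochner_Integration.integral_cong[OF refl])
    fix x :: real
    \<comment> \<open>For \<open>x < 0\<close> the density vanishes; at \<open>x = 0\<close> the
      power does.\<close>
    show "erlang_density (d - 1) 1 x *\<^sub>R complex_of_real x powr z
        = ?c * (indicator {0<..} x *\<^sub>R ?g x)"
    proof (cases "0 < x")
      case True
      have "of_nat d + z - 1 = of_nat (d - 1) + z" using assms(2) by (simp add: of_nat_diff)
      hence "complex_of_real x powr (of_nat d + z - 1) = of_real (x ^ (d - 1)) * complex_of_real x powr z"
        using True by (simp only: powr_add) simp
      thus ?thesis using True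
        by (simp add: erlang_density_def scaleR_conv_of_real exp_minus field_simps exp_of_real)
    qed (auto simp: erlang_density_def)
  qed
  also have "\<dots> = ?c * (\<integral>x. indicator {0<..} x *\<^sub>R ?g x \<partial>lborel)"
    by (rule integral_mult_right_zero)
  \<comment> \<open>The Gamma integral is available as a gauge integral, which is reached through
    Lebesgue measure, the completion of \<open>lborel\<close>.\<close>
  also have "(\<integral>x. indicator {0<..} x *\<^sub>R ?g x \<partial>lborel) = (LINT x:{0<..} | lebesgue. ?g x)"
    unfolding set_lebesgue_integral_def by (rule integral_completion[symmetric]) measurable
  also have "\<dots> = integral {0<..} ?g"
    by (rule set_lebesgue_integral_eq_integral(2)[OF ai])
  also have "\<dots> = Gamma ?w" by (rule integral_unique[OF Gamma_integral_complex'[OF w]])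
  finally show ?thesis by simp
qed

context coupon_collector
begin

text \<open>Poissonization: with a Poisson(\<open>t\<close>) number of trials the letters have
  independent Poisson(\<open>t / n\<close>) counts. Analytically, this is the generating function at
  \<open>t / n\<close>, whose \<open>n\<close> factors \<open>exp (t / n)\<close> cancel against
  \<open>exp (- t)\<close>.\<close>

lemma prob_all_detected_sums:
  assumes "0 \<le> t"
  shows "(\<lambda>N. exp (- t) * t ^ N / fact N * prob {\<omega> \<in> space M. all_detected m n X N \<omega>})
    sums (1 - poisson_lt m (t / n)) ^ n"
proof -
  have "(\<lambda>N. real (covering_number m n N) * (t / n) ^ N / fact N) sums
      (exp (t / n) * (1 - poisson_lt m (t / n))) ^ n"
    using covering_number_egf[of "t / n" m n] assms by (simp add: suminf_exp_tail)
  also have "(exp (t / n) * (1 - poisson_lt m (t / n))) ^ n = exp t * (1 - poisson_lt m (t / n)) ^ n"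
    using n_pos by (simp add: power_mult_distrib exp_of_nat_mult[symmetric])
  finally have "(\<lambda>N. exp (- t) * (real (covering_number m n N) * (t / n) ^ N / fact N)) sums
      (exp (- t) * (exp t * (1 - poisson_lt m (t / n)) ^ n))"
    by (rule sums_mult)
  also have "exp (- t) * (exp t * (1 - poisson_lt m (t / n)) ^ n) = (1 - poisson_lt m (t / n)) ^ n"
    by (simp add: exp_minus)
  finally show ?thesis by (simp add: prob_all_detected power_divide mult_ac)
qed

text \<open>
  Averaging \<open>P(D \<le> N)\<close> over a Poisson(\<open>t\<close>) distributed \<open>N\<close> stays below the probability of
  completion, and tends to 1 as \<open>t\<close> grows.
\<close>

lemma AE_complete: "AE \<omega> in M. \<exists>N. all_detected m n X N \<omega>"
proof -
  let ?a = "\<P>(\<omega> in M. \<exists>N. all_detected m n X N \<omega>)"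
  have le: "(1 - poisson_lt m (t / n)) ^ n \<le> ?a" if t: "0 \<le> t" for t
  proof (rule sums_le[OF _ prob_all_detected_sums[OF t]])
    have "(\<lambda>N. t ^ N / fact N) sums exp t"
      using exp_converges[of t] by (simp add: field_simps)
    hence "(\<lambda>N. exp (- t) * (t ^ N / fact N) * ?a) sums (exp (- t) * exp t * ?a)"
      by (intro sums_mult sums_mult2)
    thus "(\<lambda>N. exp (- t) * t ^ N / fact N * ?a) sums ?a"
      by (simp add: mult_exp_exp)
    show "exp (- t) * t ^ N / fact N * prob {\<omega> \<in> space M. all_detected m n X N \<omega>}
        \<le> exp (- t) * t ^ N / fact N * ?a" for N
      using t by (intro mult_left_mono finite_measure_mono) auto
  qed
  have "filterlim (\<lambda>t. t / real n) at_top at_top"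
    using n_pos by real_asymp
  hence "((\<lambda>t. poisson_lt m (t / n)) \<longlongrightarrow> 0) at_top"
    by (rule filterlim_compose[OF poisson_lt_tendsto_0])
  hence "((\<lambda>t. (1 - poisson_lt m (t / n)) ^ n) \<longlongrightarrow> (1 - 0) ^ n) at_top"
    by (intro tendsto_intros)
  moreover have "eventually (\<lambda>t. (1 - poisson_lt m (t / n)) ^ n \<le> ?a) at_top"
    using eventually_ge_at_top[of "0 :: real"] by eventually_elim (rule le)
  ultimately have "1 \<le> ?a" by (intro tendsto_upperbound) auto
  hence "?a = 1" using prob_le_1 by (rule antisym[rotated])
  thus ?thesis by (subst (asm) prob_Collect_eq_1) auto
qed

section \<open>Independence of the number of trials and the arrival times\<close>

lemma measurable_U_seq [measurable]: "(\<lambda>\<omega> k. U k \<omega>) \<in> measurable M (PiM UNIV (\<lambda>_. borel))"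
  by (rule measurable_PiM_single'[OF measurable_U]) (simp add: PiE_UNIV_domain)

text \<open>
  \<open>indep_var\<close> demands equal types of both variables, so independence is stated as a product law.
\<close>

lemma distr_coupon_D_U:
  "distr M (count_space UNIV) (coupon_D m n X) \<Otimes>\<^sub>M distr M (PiM UNIV (\<lambda>_. borel)) (\<lambda>\<omega> k. U k \<omega>)
    = distr M (count_space UNIV \<Otimes>\<^sub>M PiM UNIV (\<lambda>_. borel)) (\<lambda>\<omega>. (coupon_D m n X \<omega>, \<lambda>k. U k \<omega>))"
  (is "?MD \<Otimes>\<^sub>M ?MU = ?MDU")
proof (rule pair_measure_eqI)
  interpret D: prob_space ?MD by (rule prob_space_distr[OF measurable_coupon_D_X])
  interpret V: prob_space ?MU by (rule prob_space_distr[OF measurable_U_seq])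
  show "sigma_finite_measure ?MD" by (rule D.sigma_finite_measure_axioms)
  show "sigma_finite_measure ?MU" by (rule V.sigma_finite_measure_axioms)
  show "sets (?MD \<Otimes>\<^sub>M ?MU) = sets ?MDU"
    unfolding sets_distr by (rule sets_pair_measure_cong) simp_all
next
  fix A B assume A: "A \<in> sets ?MD" and B: "B \<in> sets ?MU"
  let ?PX = "PiM UNIV (\<lambda>_::nat. count_space (UNIV :: nat set))" and ?PU = "PiM UNIV (\<lambda>_::nat. borel :: real measure)"
  let ?D = "coupon_D m n X" and ?D' = "coupon_D m n (\<lambda>k x. x k)"
  let ?a = "?D -` A \<inter> space M" and ?b = "(\<lambda>\<omega> k. U k \<omega>) -` B \<inter> space M"
  have "?D' \<in> measurable ?PX (count_space UNIV)"
    by (rule measurable_coupon_D) (rule measurable_component_singleton, simp)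
  hence "?D' -` A \<in> sets ?PX"
    using measurable_sets[of ?D' ?PX "count_space UNIV" A] by (simp add: space_PiM)
  moreover have "?a = (\<lambda>\<omega> k. X k \<omega>) -` (?D' -` A) \<inter> space M"
    by (auto simp: coupon_D_def all_detected_def)
  ultimately have a: "?a \<in> sets (vimage_algebra (space M) (\<lambda>\<omega> k. X k \<omega>) ?PX)"
    by (auto intro: in_vimage_algebra)
  have b: "?b \<in> sets (vimage_algebra (space M) (\<lambda>\<omega> k. U k \<omega>) ?PU)"
    using B by (auto intro: in_vimage_algebra)
  have "emeasure ?MD A * emeasure ?MU B = emeasure M ?a * emeasure M ?b"
    using A B by (simp add: emeasure_distr)
  also have "\<dots> = emeasure M (?a \<inter> ?b)"
    using indep_setD[OF coupons_interarrivals_indep a b]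
    by (simp add: emeasure_eq_measure ennreal_mult[symmetric])
  also have "?a \<inter> ?b = (\<lambda>\<omega>. (?D \<omega>, \<lambda>k. U k \<omega>)) -` (A \<times> B) \<inter> space M" by auto
  also have "emeasure M \<dots> = emeasure ?MDU (A \<times> B)"
    using A B by (intro emeasure_distr[symmetric]) auto
  finally show "emeasure ?MD A * emeasure ?MU B = emeasure ?MDU (A \<times> B)" .
qed

lemma measurable_arrival_time [measurable]: "arrival_time U d \<in> borel_measurable M"
  unfolding arrival_time_def[abs_def] by measurable

lemma distributed_arrival_time:
  assumes "d \<ge> 1"
  shows "distributed M lborel (arrival_time U d) (erlang_density (d - 1) 1)"
proof -
  have "distributed M lborel (\<lambda>\<omega>. \<Sum>i\<in>{..<d}. U i \<omega>) (erlang_density (card {..<d} - 1) 1)"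
    using assms interarrivals_exponential
    by (intro exponential_distributed_sum indep_vars_subset[OF interarrivals_indep]) (auto simp: lessThan_empty_iff)
  thus ?thesis by (simp add: arrival_time_def[abs_def])
qed

text \<open>The number of trials depends on the coupons only, the arrival times on \<open>U\<close>
  only. By the product law, Fubini allows the number to be frozen at \<open>\<omega>\<close> while
  the arrival time is averaged over a separate \<open>\<omega>'\<close>.\<close>

lemma integral_at_coupon_D:
  fixes f :: "nat \<Rightarrow> real \<Rightarrow> 'b :: {banach, second_countable_topology}"
  assumes f [measurable]: "\<And>d. f d \<in> borel_measurable borel"
    and int: "integrable M (\<lambda>\<omega>. f (coupon_D m n X \<omega>) (arrival_time U (coupon_D m n X \<omega>) \<omega>))"
  shows "integrable M (\<lambda>\<omega>. \<integral>\<omega>'. f (coupon_D m n X \<omega>) (arrival_time U (coupon_D m n X \<omega>) \<omega>') \<partial>M)"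
    and "(\<integral>\<omega>. f (coupon_D m n X \<omega>) (arrival_time U (coupon_D m n X \<omega>) \<omega>) \<partial>M)
      = (\<integral>\<omega>. \<integral>\<omega>'. f (coupon_D m n X \<omega>) (arrival_time U (coupon_D m n X \<omega>) \<omega>') \<partial>M \<partial>M)"
proof -
  let ?D = "coupon_D m n X" and ?V = "\<lambda>\<omega> k. U k \<omega>"
  let ?N = "PiM UNIV (\<lambda>_::nat. borel :: real measure)"
  let ?MD = "distr M (count_space UNIV) ?D" and ?MU = "distr M ?N ?V"
  define g where "g = (\<lambda>(d::nat, u). f d (\<Sum>i<d. u i))"
  have g1: "(\<lambda>u. g (d, u)) \<in> borel_measurable ?N" for d
    unfolding g_def by simp
  \<comment> \<open>The first coordinate is discrete, so measurability for each fixed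
    \<open>d\<close> suffices.\<close>
  have g [measurable]: "g \<in> borel_measurable (count_space UNIV \<Otimes>\<^sub>M ?N)"
    by (rule measurable_pair_measure_countable1) (use g1 in auto)
  have gU: "g (d, ?V \<omega>) = f d (arrival_time U d \<omega>)" for d \<omega>
    by (simp add: g_def arrival_time_def)
  interpret D: prob_space ?MD by (rule prob_space_distr[OF measurable_coupon_D_X])
  interpret V: prob_space ?MU by (rule prob_space_distr[OF measurable_U_seq])
  interpret P: pair_prob_space ?MD ?MU ..
  note eq = distr_coupon_D_U[of m]
  have inner: "(\<integral>u. g (d, u) \<partial>?MU) = (\<integral>\<omega>'. f d (arrival_time U d \<omega>') \<partial>M)" for d
    by (subst integral_distr) (use g1 gU in auto)
  have int': "integrable (?MD \<Otimes>\<^sub>M ?MU) g"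
    unfolding eq by (subst integrable_distr_eq) (use int gU in auto)
  have "integrable ?MD (\<lambda>d. \<integral>u. g (d, u) \<partial>?MU)" by (rule P.integrable_fst'[OF int'])
  thus "integrable M (\<lambda>\<omega>. \<integral>\<omega>'. f (?D \<omega>) (arrival_time U (?D \<omega>) \<omega>') \<partial>M)"
    unfolding inner by (subst (asm) integrable_distr_eq) auto
  have "(\<integral>\<omega>. f (?D \<omega>) (arrival_time U (?D \<omega>) \<omega>) \<partial>M) = integral\<^sup>L (?MD \<Otimes>\<^sub>M ?MU) g"
    unfolding eq by (subst integral_distr) (use gU in auto)
  also have "\<dots> = (\<integral>d. \<integral>u. g (d, u) \<partial>?MU \<partial>?MD)" by (rule P.integral_fst'[OF int', symmetric])
  also have "\<dots> = (\<integral>\<omega>. \<integral>\<omega>'. f (?D \<omega>) (arrival_time U (?D \<omega>) \<omega>') \<partial>M \<partial>M)"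
    unfolding inner by (subst integral_distr) auto
  finally show "(\<integral>\<omega>. f (?D \<omega>) (arrival_time U (?D \<omega>) \<omega>) \<partial>M)
      = (\<integral>\<omega>. \<integral>\<omega>'. f (?D \<omega>) (arrival_time U (?D \<omega>) \<omega>') \<partial>M \<partial>M)" .
qed

end

text \<open>For \<open>k < m\<close> one has
  \<open>x ^ k \<le> \<theta> ^ m * (x / \<theta>) ^ k\<close>, and what remains is a partial sum of
  the series of \<open>exp (x / \<theta>)\<close>.\<close>

lemma poisson_lt_chernoff:
  assumes "0 \<le> x" "1 \<le> \<theta>"
  shows "poisson_lt m x \<le> \<theta> ^ m * exp (x / \<theta> - x)"
proof -
  have "(\<Sum>k<m. x ^ k / fact k) \<le> (\<Sum>k<m. \<theta> ^ m * ((x / \<theta>) ^ k / fact k))"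
  proof (intro sum_mono)
    fix k assume k: "k \<in> {..<m}"
    have "x ^ k = \<theta> ^ k * (x / \<theta>) ^ k" using assms by (simp add: power_divide)
    also have "\<dots> \<le> \<theta> ^ m * (x / \<theta>) ^ k"
      using assms k by (intro mult_right_mono power_increasing) auto
    finally show "x ^ k / fact k \<le> \<theta> ^ m * ((x / \<theta>) ^ k / fact k)"
      by (simp add: divide_right_mono)
  qed
  also have "\<dots> = \<theta> ^ m * (\<Sum>k<m. (x / \<theta>) ^ k / fact k)" by (simp add: sum_distrib_left)
  also have "\<dots> \<le> \<theta> ^ m * exp (x / \<theta>)"
  proof (intro mult_left_mono)
    have "poisson_lt m (x / \<theta>) \<le> 1" using assms by (intro poisson_lt_le_1) auto
    thus "(\<Sum>k<m. (x / \<theta>) ^ k / fact k) \<le> exp (x / \<theta>)"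
      by (simp add: poisson_lt_def exp_minus field_simps)
  qed (use assms in auto)
  finally have "poisson_lt m x \<le> exp (- x) * (\<theta> ^ m * exp (x / \<theta>))"
    unfolding poisson_lt_def by (intro mult_left_mono) auto
  thus ?thesis by (simp add: exp_diff exp_minus field_simps)
qed

section \<open>Tails and moments\<close>

text \<open>One term of the exponential series bounds the power by a constant times
  \<open>exp (real (K + k + 1) / 2)\<close>. Half of the decay is left and gives a geometric
  majorant.\<close>

lemma summable_power_exp: "summable (\<lambda>k. real (K + k + 1) ^ p * exp (- real k))"
proof (rule summable_comparison_test')
  let ?c = "fact p * 2 ^ p * exp (real (K + 1) / 2)"
  show "summable (\<lambda>k. ?c * exp (- 1 / 2) ^ k)"
    by (intro summable_mult summable_geometric) simp
  fix k :: nat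
  let ?y = "real (K + k + 1) / 2"
  have "(\<lambda>i. ?y ^ i / fact i) sums exp ?y"
    using exp_converges[of ?y] by (simp add: field_simps)
  hence "?y ^ p / fact p \<le> exp ?y"
    using sum_le_suminf[of "\<lambda>i. ?y ^ i / fact i" "{p}"] by (auto simp: sums_iff)
  hence "real (K + k + 1) ^ p \<le> fact p * 2 ^ p * exp ?y"
    by (simp add: power_divide field_simps)
  hence "real (K + k + 1) ^ p * exp (- real k) \<le> fact p * 2 ^ p * exp ?y * exp (- real k)"
    by (intro mult_right_mono) auto
  also have "\<dots> = ?c * (exp (real k / 2) * exp (- real k))"
    by (simp add: exp_add[symmetric] add_divide_distrib)
  also have "exp (real k / 2) * exp (- real k) = exp (- 1 / 2) ^ k"
    by (simp add: exp_add[symmetric] exp_of_nat_mult[symmetric])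
  finally show "norm (real (K + k + 1) ^ p * exp (- real k)) \<le> ?c * exp (- 1 / 2) ^ k"
    by simp
qed

text \<open>It depends on the power and the cut only, so for the asymptotics it suffices that the
  prefactor \<open>c\<close> of the tail bound vanishes.\<close>

definition tail_moment_const :: "nat \<Rightarrow> nat \<Rightarrow> real" where
  "tail_moment_const p K = (\<Sum>k. real (K + k + 1) ^ p * exp (- real k))"

text \<open>The range above \<open>K\<close> is cut into unit layers; on the layer from
  \<open>K + k\<close> to \<open>K + k + 1\<close> the power is at most
  \<open>real (K + k + 1) ^ p\<close>. The sum over the layers is an integrable majorant, integrated
  term by term.\<close>

lemma (in prob_space)
  fixes Y :: "'a \<Rightarrow> real"
  assumes Y [measurable]: "Y \<in> borel_measurable M"
    and tail: "\<And>k. prob {\<omega> \<in> space M. real (K + k) < Y \<omega>} \<le> c * exp (- real k)"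
  shows integrable_tail_moment: "integrable M (\<lambda>\<omega>. indicator {real K<..} (Y \<omega>) * Y \<omega> ^ p)"
    and tail_moment_le: "(\<integral>\<omega>. indicator {real K<..} (Y \<omega>) * Y \<omega> ^ p \<partial>M) \<le> c * tail_moment_const p K"
proof -
  \<comment> \<open>The indicator is that of the whole ray above \<open>K + k\<close>. This
    overcounts, but makes the integral a tail probability.\<close>
  let ?f = "\<lambda>k \<omega>. real (K + k + 1) ^ p * indicator {real (K + k)<..} (Y \<omega>)"
  have I: "(\<integral>\<omega>. indicat_real {real (K + k)<..} (Y \<omega>) \<partial>M) = prob {\<omega> \<in> space M. real (K + k) < Y \<omega>}" for k
  proof -
    have "(\<integral>\<omega>. indicat_real {real (K + k)<..} (Y \<omega>) \<partial>M)
        = (\<integral>\<omega>. indicat_real {\<omega> \<in> space M. real (K + k) < Y \<omega>} \<omega> \<partial>M)"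
      by (intro Bochner_Integration.integral_cong) (auto simp: indicator_def)
    thus ?thesis by simp
  qed
  have int: "integrable M (?f k)" for k
    by (intro integrable_mult_right integrable_const_bound[where B = 1]) (auto simp: indicator_def)
  have le: "norm (integral\<^sup>L M (?f k)) \<le> c * (real (K + k + 1) ^ p * exp (- real k))" for k
  proof -
    have "integral\<^sup>L M (?f k) = real (K + k + 1) ^ p * prob {\<omega> \<in> space M. real (K + k) < Y \<omega>}"
      by (simp only: integral_mult_right_zero I)
    also have "\<dots> \<le> real (K + k + 1) ^ p * (c * exp (- real k))"
      by (intro mult_left_mono tail) auto
    finally show ?thesis by (simp add: integral_nonneg_AE mult_ac)
  qed
  have sm: "summable (\<lambda>k. c * (real (K + k + 1) ^ p * exp (- real k)))"
    by (intro summable_mult summable_power_exp)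
  have fin: "summable (\<lambda>k. ?f k \<omega>)" for \<omega>
  proof (rule summable_finite)
    show "finite {..nat \<lceil>Y \<omega>\<rceil>}" by simp
    show "?f k \<omega> = 0" if "k \<notin> {..nat \<lceil>Y \<omega>\<rceil>}" for k
    proof -
      have "Y \<omega> \<le> real k" using that by (simp add: not_le) linarith
      thus ?thesis by (auto simp: indicator_def)
    qed
  qed
  have fin': "AE \<omega> in M. summable (\<lambda>k. norm (?f k \<omega>))" using fin by simp
  have norm_int: "(\<integral>\<omega>. norm (?f k \<omega>) \<partial>M) = integral\<^sup>L M (?f k)" for k by simp
  have sums: "summable (\<lambda>k. \<integral>\<omega>. norm (?f k \<omega>) \<partial>M)"
    unfolding norm_int by (rule summable_comparison_test'[OF sm]) (rule le)
  note S = integrable_suminf[OF int fin' sums] integral_suminf[OF int fin' sums]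
  have bound: "indicator {real K<..} (Y \<omega>) * Y \<omega> ^ p \<le> (\<Sum>k. ?f k \<omega>)"
      "0 \<le> indicator {real K<..} (Y \<omega>) * Y \<omega> ^ p" for \<omega>
  proof -
    show "indicator {real K<..} (Y \<omega>) * Y \<omega> ^ p \<le> (\<Sum>k. ?f k \<omega>)"
    proof (cases "real K < Y \<omega>")
      case True
      \<comment> \<open>The index of the layer containing \<open>Y \<omega>\<close>; layers are open
        on the left and closed on the right.\<close>
      define k where "k = nat \<lceil>Y \<omega>\<rceil> - 1 - K"
      have k: "real (K + k) < Y \<omega>" "Y \<omega> \<le> real (K + k + 1)"
        using True unfolding k_def by linarith+
      have "indicator {real K<..} (Y \<omega>) * Y \<omega> ^ p \<le> ?f k \<omega>"
        using True k by (simp add: power_mono)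
      also have "\<dots> \<le> (\<Sum>i. ?f i \<omega>)"
      proof -
        have "(\<Sum>i\<in>insert k {}. ?f i \<omega>) \<le> (\<Sum>i. ?f i \<omega>)"
          by (rule sum_le_suminf[OF fin]) auto
        thus ?thesis by (subst (asm) sum.insert) simp_all
      qed
      finally show ?thesis .
    qed (auto intro: suminf_nonneg[OF fin])
    show "0 \<le> indicator {real K<..} (Y \<omega>) * Y \<omega> ^ p"
      by (auto simp: indicator_def)
  qed
  show int': "integrable M (\<lambda>\<omega>. indicator {real K<..} (Y \<omega>) * Y \<omega> ^ p)"
  proof (rule Bochner_Integration.integrable_bound[OF S(1)])
    show "(\<lambda>\<omega>. indicator {real K<..} (Y \<omega>) * Y \<omega> ^ p) \<in> borel_measurable M" by measurable
    show "AE \<omega> in M. norm (indicator {real K<..} (Y \<omega>) * Y \<omega> ^ p) \<le> norm (\<Sum>k. ?f k \<omega>)"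
    proof (rule AE_I2)
      fix \<omega>
      have "indicator {real K<..} (Y \<omega>) * Y \<omega> ^ p \<le> \<bar>\<Sum>k. ?f k \<omega>\<bar>"
        using bound(1)[of \<omega>] by linarith
      thus "norm (indicator {real K<..} (Y \<omega>) * Y \<omega> ^ p) \<le> norm (\<Sum>k. ?f k \<omega>)"
        unfolding real_norm_def by (subst abs_of_nonneg[OF bound(2)])
    qed
  qed
  have "(\<integral>\<omega>. indicator {real K<..} (Y \<omega>) * Y \<omega> ^ p \<partial>M) \<le> (\<integral>\<omega>. (\<Sum>k. ?f k \<omega>) \<partial>M)"
    by (intro integral_mono int' S(1) bound)
  also have "\<dots> = (\<Sum>k. integral\<^sup>L M (?f k))" by (rule S(2))
  also have "\<dots> \<le> (\<Sum>k. c * (real (K + k + 1) ^ p * exp (- real k)))"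
  proof (rule suminf_le)
    show "integral\<^sup>L M (?f k) \<le> c * (real (K + k + 1) ^ p * exp (- real k))" for k
      using le[of k] unfolding real_norm_def by linarith
    show "summable (\<lambda>k. integral\<^sup>L M (?f k))" using sums unfolding norm_int .
  qed (fact sm)
  also have "\<dots> = c * tail_moment_const p K"
    unfolding tail_moment_const_def by (rule suminf_mult[OF summable_power_exp])
  finally show "(\<integral>\<omega>. indicator {real K<..} (Y \<omega>) * Y \<omega> ^ p \<partial>M) \<le> c * tail_moment_const p K" .
qed

section \<open>Exact law and tails of the completion time\<close>

context coupon_collector
begin

lemma measurable_coupon_Delta_XU:
  "m \<ge> 1 \<Longrightarrow> coupon_Delta m n X U \<in> borel_measurable M"
  by (rule measurable_coupon_Delta[OF measurable_X measurable_U _ n_pos])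

lemma AE_coupon_Delta:
  assumes "m \<ge> 1"
  shows "AE \<omega> in M. coupon_Delta m n X U \<omega> = arrival_time U (coupon_D m n X \<omega>) \<omega> \<and>
    0 \<le> coupon_Delta m n X U \<omega> \<and> 1 \<le> coupon_D m n X \<omega> \<and>
    (\<forall>N. all_detected m n X N \<omega> \<longleftrightarrow> coupon_D m n X \<omega> \<le> N)"
  using AE_U_pos AE_complete[of m]
proof eventually_elim
  case (elim \<omega>)
  have D: "all_detected m n X N \<omega> \<longleftrightarrow> coupon_D m n X \<omega> \<le> N" for N
    using elim(2) by (rule all_detected_iff_coupon_D_le)
  have "coupon_Delta m n X U \<omega> = arrival_time U (coupon_D m n X \<omega>) \<omega>"
    unfolding arrival_time_def using elim assms n_pos by (intro coupon_Delta_eq_sum) auto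
  moreover have "0 \<le> arrival_time U (coupon_D m n X \<omega>) \<omega>"
    unfolding arrival_time_def using elim(1) by (intro sum_nonneg) (auto intro: less_imp_le)
  moreover have "coupon_D m n X \<omega> \<noteq> 0"
    using D[of 0] not_all_detected_0[OF assms n_pos, of X \<omega>] by auto
  ultimately show ?case using D by auto
qed

lemma prob_arrival_time_le:
  assumes "d \<ge> 1" "0 \<le> t"
  shows "prob {\<omega> \<in> space M. arrival_time U d \<omega> \<le> t} = 1 - poisson_lt d t"
proof -
  have "prob {\<omega> \<in> space M. arrival_time U d \<omega> \<le> t} = erlang_CDF (d - 1) 1 t"
    by (rule erlang_distributed_le[OF distributed_arrival_time]) (use assms in auto)
  also have "{..d - 1} = {..<d}" using assms by auto
  hence "erlang_CDF (d - 1) 1 t = 1 - poisson_lt d t"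
    using assms by (simp add: erlang_CDF_def poisson_lt_def sum_distrib_left mult_ac)
  finally show ?thesis .
qed

text \<open>For fixed \<open>d \<ge> 1\<close>, the \<open>d\<close>-th arrival is at most
  \<open>t\<close> with the probability that a Poisson(\<open>t\<close>) variable is at least
  \<open>d\<close>. Expanding this at the random number of trials and integrating termwise gives the
  Poisson average computed in \<open>prob_all_detected_sums\<close>.\<close>

lemma prob_coupon_Delta_le:
  assumes m: "m \<ge> 1" and t: "0 \<le> t"
  shows "prob {\<omega> \<in> space M. coupon_Delta m n X U \<omega> \<le> t} = (1 - poisson_lt m (t / n)) ^ n"
proof -
  note measurable_coupon_Delta_XU[OF m, measurable]
  let ?D = "coupon_D m n X"
  let ?f = "\<lambda>N \<omega>. exp (- t) * t ^ N / fact N * indicator {\<omega> \<in> space M. all_detected m n X N \<omega>} \<omega>"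
  let ?g = "\<lambda>\<omega>. indicator {..t} (arrival_time U (?D \<omega>) \<omega>) :: real"
  have g [measurable]: "?g \<in> borel_measurable M"
    by (rule measurable_compose_countable[OF _ measurable_coupon_D_X]) measurable
  have gi: "integrable M ?g"
    by (rule integrable_const_bound[where B = 1]) auto
  have P: "(\<lambda>N. exp (- t) * t ^ N / fact N) sums 1"
  proof -
    have "(\<lambda>N. t ^ N / fact N) sums exp t"
      using exp_converges[of t] by (simp add: field_simps)
    hence "(\<lambda>N. exp (- t) * (t ^ N / fact N)) sums (exp (- t) * exp t)" by (rule sums_mult)
    thus ?thesis by (simp add: mult_exp_exp)
  qed
  have int: "integrable M (?f N)" for N
    by (intro integrable_mult_right integrable_real_indicator) (auto simp: emeasure_eq_measure)
  have nn: "0 \<le> ?f N \<omega>" for N \<omega> using t by simp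
  have "summable (\<lambda>N. norm (?f N \<omega>))" for \<omega>
    by (rule summable_comparison_test'[OF sums_summable[OF P]]) (use t in \<open>auto simp: indicator_def\<close>)
  hence fin: "AE \<omega> in M. summable (\<lambda>N. norm (?f N \<omega>))" by simp
  have fI: "integral\<^sup>L M (?f N) = exp (- t) * t ^ N / fact N * prob {\<omega> \<in> space M. all_detected m n X N \<omega>}" for N
    by simp
  have norm_int: "(\<integral>\<omega>. norm (?f N \<omega>) \<partial>M) = integral\<^sup>L M (?f N)" for N
    using t by simp
  have sums: "summable (\<lambda>N. \<integral>\<omega>. norm (?f N \<omega>) \<partial>M)"
    unfolding norm_int fI by (rule sums_summable[OF prob_all_detected_sums[OF t]])
  have "prob {\<omega> \<in> space M. coupon_Delta m n X U \<omega> \<le> t}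
      = (\<integral>\<omega>. indicator {\<omega> \<in> space M. coupon_Delta m n X U \<omega> \<le> t} \<omega> \<partial>M)"
    by simp
  also have "\<dots> = (\<integral>\<omega>. ?g \<omega> \<partial>M)"
    using AE_coupon_Delta[OF m] AE_space
    by (intro integral_cong_AE) (measurable, auto elim!: eventually_mono simp: indicator_def)
  also have "\<dots> = (\<integral>\<omega>. \<integral>\<omega>'. indicator {..t} (arrival_time U (?D \<omega>) \<omega>') \<partial>M \<partial>M)"
    by (rule integral_at_coupon_D(2)[where f = "\<lambda>_. indicator {..t}"]) (use gi in auto)
  also have "\<dots> = (\<integral>\<omega>. (\<Sum>N. ?f N \<omega>) \<partial>M)"
  proof (rule integral_cong_AE)
    show "(\<lambda>\<omega>. \<integral>\<omega>'. indicator {..t} (arrival_time U (?D \<omega>) \<omega>') \<partial>M) \<in> borel_measurable M"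
      by (rule measurable_compose[OF measurable_coupon_D_X]) simp
    show "AE \<omega> in M. (\<integral>\<omega>'. indicator {..t} (arrival_time U (?D \<omega>) \<omega>') \<partial>M) = (\<Sum>N. ?f N \<omega>)"
      using AE_coupon_Delta[OF m] AE_space
    proof eventually_elim
      case (elim \<omega>)
      let ?d = "?D \<omega>"
      have "(\<integral>\<omega>'. indicator {..t} (arrival_time U ?d \<omega>') \<partial>M)
          = (\<integral>\<omega>'. indicator {\<omega>' \<in> space M. arrival_time U ?d \<omega>' \<le> t} \<omega>' \<partial>M)"
        by (intro Bochner_Integration.integral_cong) (auto simp: indicator_def)
      also have "\<dots> = prob {\<omega>' \<in> space M. arrival_time U ?d \<omega>' \<le> t}" by simp
      also have "\<dots> = 1 - poisson_lt ?d t"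
        using elim t by (intro prob_arrival_time_le) auto
      also have "\<dots> = exp (- t) * (\<Sum>N. if ?d \<le> N then t ^ N / fact N else 0)"
        by (simp add: suminf_exp_tail exp_minus)
      also have "\<dots> = (\<Sum>N. exp (- t) * (if ?d \<le> N then t ^ N / fact N else 0))"
        by (rule suminf_mult[symmetric, OF summable_exp_tail])
      \<comment> \<open>The cutoff \<open>?d \<le> N\<close> is the event that \<open>N\<close>
        trials complete the collection.\<close>
      also have "\<dots> = (\<Sum>N. ?f N \<omega>)"
        using elim by (intro suminf_cong) (auto simp: indicator_def)
      finally show ?case .
    qed
  qed measurable
  also have "\<dots> = (\<Sum>N. integral\<^sup>L M (?f N))" by (rule integral_suminf[OF int fin sums])
  also have "\<dots> = (1 - poisson_lt m (t / n)) ^ n"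
    unfolding fI by (rule sums_unique[symmetric, OF prob_all_detected_sums[OF t]])
  finally show ?thesis .
qed

text \<open>The union bound over the coupons, obtained as Bernoulli's inequality for
  \<open>(1 - ?q) ^ n\<close>.\<close>

lemma prob_coupon_Delta_gt:
  assumes m: "m \<ge> 1" and t: "0 \<le> t"
  shows "prob {\<omega> \<in> space M. t < coupon_Delta m n X U \<omega>} \<le> n * poisson_lt m (t / n)"
proof -
  note measurable_coupon_Delta_XU[OF m, measurable]
  let ?q = "poisson_lt m (t / n)"
  have "{\<omega> \<in> space M. t < coupon_Delta m n X U \<omega>} = space M - {\<omega> \<in> space M. coupon_Delta m n X U \<omega> \<le> t}"
    by auto
  hence "prob {\<omega> \<in> space M. t < coupon_Delta m n X U \<omega>} = 1 - (1 - ?q) ^ n"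
    by (simp add: prob_compl prob_coupon_Delta_le[OF m t])
  also have "1 + real n * (- ?q) \<le> (1 + - ?q) ^ n"
    using t by (intro Bernoulli_inequality) (simp add: poisson_lt_le_1)
  hence "1 - (1 - ?q) ^ n \<le> n * ?q" by simp
  finally show ?thesis .
qed

text \<open>The Chernoff bound with \<open>\<theta> = 2\<close> keeps half of the exponent
  \<open>L * real (K + k)\<close>. The part from \<open>K\<close> retains the factor
  \<open>L\<close>, which later makes the bound small; \<open>2 \<le> L\<close> reduces the part
  from \<open>k\<close> to \<open>exp (- real k)\<close>.\<close>

lemma coupon_Delta_tail_prob:
  fixes L :: real
  assumes m: "m \<ge> 1" and L: "2 \<le> L"
  shows "prob {\<omega> \<in> space M. real (K + k) < coupon_Delta m n X U \<omega> / (n * L)}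
    \<le> real n * 2 ^ m * exp (- L * real K / 2) * exp (- real k)"
proof -
  let ?t = "n * L * real (K + k)"
  have "{\<omega> \<in> space M. real (K + k) < coupon_Delta m n X U \<omega> / (n * L)} = {\<omega> \<in> space M. ?t < coupon_Delta m n X U \<omega>}"
    using n_pos L by (auto simp: field_simps)
  hence "prob {\<omega> \<in> space M. real (K + k) < coupon_Delta m n X U \<omega> / (n * L)} \<le> n * poisson_lt m (?t / n)"
    using prob_coupon_Delta_gt[OF m, of ?t] n_pos L by simp
  also have "?t / n = L * real (K + k)" using n_pos by simp
  also have "n * poisson_lt m (L * real (K + k))
      \<le> n * (2 ^ m * exp (L * real (K + k) / 2 - L * real (K + k)))"
    using L by (intro mult_left_mono poisson_lt_chernoff) auto
  also have "\<dots> \<le> n * (2 ^ m * (exp (- L * K / 2) * exp (- real k)))"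
  proof (intro mult_left_mono)
    have "2 * real k \<le> L * real k" using L by (intro mult_right_mono) auto
    hence "L * real (K + k) / 2 - L * real (K + k) \<le> - L * K / 2 - real k"
      by (simp add: field_simps)
    thus "exp (L * real (K + k) / 2 - L * real (K + k)) \<le> exp (- L * K / 2) * exp (- real k)"
      by (simp add: exp_add[symmetric])
  qed auto
  finally show ?thesis by (simp add: mult_ac)
qed

lemma
  fixes K p m :: nat and L :: real
  assumes m: "m \<ge> 1" and L: "2 \<le> L"
  shows integrable_coupon_Delta_tail: "integrable M (\<lambda>\<omega>.
      indicator {real K<..} (coupon_Delta m n X U \<omega> / (n * L)) * (coupon_Delta m n X U \<omega> / (n * L)) ^ p)"
    and coupon_Delta_tail_le: "(\<integral>\<omega>.
      indicator {real K<..} (coupon_Delta m n X U \<omega> / (n * L)) * (coupon_Delta m n X U \<omega> / (n * L)) ^ p \<partial>M)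
      \<le> real n * 2 ^ m * exp (- L * real K / 2) * tail_moment_const p K"
  using measurable_coupon_Delta_XU[OF m]
  by (intro integrable_tail_moment[OF _ coupon_Delta_tail_prob[OF m L]]
      tail_moment_le[OF _ coupon_Delta_tail_prob[OF m L]]; measurable)+

end

section \<open>Equality of the two expectations\<close>

context coupon_collector
begin

lemma integral_arrival_time_powr:
  assumes "0 < Re z" "d \<ge> 1"
  shows "(\<integral>\<omega>. complex_of_real (arrival_time U d \<omega>) powr z \<partial>M) = Gamma (of_nat d + z) / fact (d - 1)"
proof -
  note dist = distributed_arrival_time[OF assms(2)]
  have "(\<integral>\<omega>. complex_of_real (arrival_time U d \<omega>) powr z \<partial>M)
      = (\<integral>x. complex_of_real x powr z \<partial>distr M lborel (arrival_time U d))"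
    by (rule integral_distr[symmetric]) auto
  also have "\<dots> = (\<integral>x. complex_of_real x powr z \<partial>density lborel (erlang_density (d - 1) 1))"
    by (simp only: distributed_distr_eq_density[OF dist])
  also have "\<dots> = (\<integral>x. erlang_density (d - 1) 1 x *\<^sub>R complex_of_real x powr z \<partial>lborel)"
    by (rule integral_density) auto
  finally show ?thesis by (simp only: integral_erlang_powr[OF assms])
qed

text \<open>Dominated by a constant plus a tail moment: for \<open>0 \<le> y\<close>,
  \<open>y powr Re z\<close> is at most 1 up to \<open>y = 1\<close> and at most
  \<open>y ^ p\<close> beyond.\<close>

lemma integrable_coupon_Delta_powr:
  assumes m: "m \<ge> 1" and z: "0 < Re z"
  shows "integrable M (\<lambda>\<omega>. complex_of_real (coupon_Delta m n X U \<omega>) powr z)"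
proof -
  note [measurable] = measurable_coupon_Delta_XU[OF m]
  \<comment> \<open>Scaled with \<open>L = 2\<close>, the smallest value that the tail bound
    admits.\<close>
  define Y where "Y \<omega> = coupon_Delta m n X U \<omega> / (n * 2)" for \<omega>
  define p where "p = nat \<lceil>Re z\<rceil>"
  let ?c = "(real n * 2) powr Re z"
  have p: "Re z \<le> real p" unfolding p_def by linarith
  have int: "integrable M (\<lambda>\<omega>. ?c * (1 + indicator {real 1<..} (Y \<omega>) * Y \<omega> ^ p))"
    unfolding Y_def using integrable_coupon_Delta_tail[OF m, of 2 1 p] by simp
  show ?thesis
  proof (rule Bochner_Integration.integrable_bound[OF int])
    show "AE \<omega> in M. norm (complex_of_real (coupon_Delta m n X U \<omega>) powr z)
        \<le> norm (?c * (1 + indicator {real 1<..} (Y \<omega>) * Y \<omega> ^ p))"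
      using AE_coupon_Delta[OF m]
    proof eventually_elim
      case (elim \<omega>)
      hence Y0: "0 \<le> Y \<omega>" by (simp add: Y_def)
      have "norm (complex_of_real (coupon_Delta m n X U \<omega>) powr z) = coupon_Delta m n X U \<omega> powr Re z"
        using elim by (simp add: norm_powr_real_powr)
      also have "\<dots> = ((real n * 2) * Y \<omega>) powr Re z" using n_pos by (simp add: Y_def)
      also have "\<dots> = ?c * Y \<omega> powr Re z" by (rule powr_mult)
      also have "Y \<omega> powr Re z \<le> 1 + indicator {real 1<..} (Y \<omega>) * Y \<omega> ^ p"
      proof (cases "1 < Y \<omega>")
        case True
        hence "Y \<omega> powr Re z \<le> Y \<omega> powr real p" using p by (intro powr_mono) auto
        thus ?thesis using True by (simp add: powr_realpow)
      next
        case False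
        thus ?thesis using Y0 z powr_le1[of "Re z" "Y \<omega>"] by simp
      qed
      also have "?c * (1 + indicator {real 1<..} (Y \<omega>) * Y \<omega> ^ p)
          \<le> norm (?c * (1 + indicator {real 1<..} (Y \<omega>) * Y \<omega> ^ p))"
        by simp
      finally show ?case by (simp only: mult_left_mono powr_ge_zero)
    qed
  qed measurable
qed

text \<open>Almost surely \<open>G\<close> is the mean of the power of the arrival time with the
  number of trials frozen. Fubini thus carries both integrability and the value of the integral over
  from \<open>\<Delta>\<close>.\<close>

lemma coupon_D_moment:
  assumes m: "m \<ge> 1" and z: "0 < Re z"
  defines "G \<equiv> \<lambda>\<omega>. Gamma (of_nat (coupon_D m n X \<omega>) + z) / fact (coupon_D m n X \<omega> - 1)"
  shows "integrable M G"
    and "integral\<^sup>L M G = (\<integral>\<omega>. complex_of_real (coupon_Delta m n X U \<omega>) powr z \<partial>M)"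
proof -
  note [measurable] = measurable_coupon_Delta_XU[OF m]
  let ?D = "coupon_D m n X"
  let ?f = "\<lambda>\<omega>. complex_of_real (arrival_time U (?D \<omega>) \<omega>) powr z"
  let ?I = "\<lambda>\<omega>. \<integral>\<omega>'. complex_of_real (arrival_time U (?D \<omega>) \<omega>') powr z \<partial>M"
  have f [measurable]: "?f \<in> borel_measurable M"
    by (rule measurable_compose_countable[OF _ measurable_coupon_D_X]) measurable
  have I [measurable]: "?I \<in> borel_measurable M"
    by (rule measurable_compose[OF measurable_coupon_D_X]) simp
  have G [measurable]: "G \<in> borel_measurable M"
    unfolding G_def by (rule measurable_compose[OF measurable_coupon_D_X]) simp
  have Df: "AE \<omega> in M. complex_of_real (coupon_Delta m n X U \<omega>) powr z = ?f \<omega>"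
    using AE_coupon_Delta[OF m] by eventually_elim simp
  have int: "integrable M ?f"
    by (rule integrable_cong_AE_imp[OF integrable_coupon_Delta_powr[OF m z] f Df])
  note main = integral_at_coupon_D[where f = "\<lambda>_ x. complex_of_real x powr z", OF borel_measurable_of_real_powr int]
  have IG: "AE \<omega> in M. ?I \<omega> = G \<omega>"
    using AE_coupon_Delta[OF m] by eventually_elim (simp add: G_def integral_arrival_time_powr[OF z])
  show "integrable M G" by (rule integrable_cong_AE_imp[OF main(1) G IG])
  have "integral\<^sup>L M G = integral\<^sup>L M ?I"
    using IG by (intro integral_cong_AE) auto
  also have "\<dots> = integral\<^sup>L M ?f" by (rule main(2)[symmetric])
  also have "\<dots> = (\<integral>\<omega>. complex_of_real (coupon_Delta m n X U \<omega>) powr z \<partial>M)"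
    using Df by (intro integral_cong_AE) auto
  finally show "integral\<^sup>L M G = (\<integral>\<omega>. complex_of_real (coupon_Delta m n X U \<omega>) powr z \<partial>M)" .
qed

end

section \<open>Convergence of moments\<close>

text \<open>Near a positive point the power is \<open>exp (z * ln x)\<close> with the real
  logarithm. The filter is \<open>nhds a\<close> so that the limit composes with sequences that may
  hit \<open>a\<close>.\<close>

lemma tendsto_of_real_powr:
  assumes "0 < a"
  shows "((\<lambda>x. complex_of_real x powr z) \<longlongrightarrow> complex_of_real a powr z) (nhds a)"
proof -
  have "isCont (\<lambda>x. exp (z * complex_of_real (ln x))) a"
    using assms by (intro continuous_intros) auto
  hence "((\<lambda>x. exp (z * complex_of_real (ln x))) \<longlongrightarrow> exp (z * complex_of_real (ln a))) (nhds a)"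
    unfolding isCont_def by (rule tendsto_at_iff_tendsto_nhds[THEN iffD1])
  moreover have "eventually (\<lambda>x. exp (z * complex_of_real (ln x)) = complex_of_real x powr z) (nhds a)"
    using eventually_nhds_in_open[of "{0<..}" a] assms
    by (auto elim!: eventually_mono simp: powr_def Ln_of_real)
  ultimately show ?thesis
    using assms by (subst (asm) tendsto_cong) (auto simp: powr_def Ln_of_real)
qed

text \<open>Between \<open>s\<^sub>1\<close> and \<open>s\<^sub>2\<close> the error is at most
  \<open>\<epsilon>\<close>. Elsewhere each of the two powers is at most
  \<open>real K powr Re z\<close>, whence the factor 2; the excess when \<open>Y\<close> is above
  \<open>K\<close> is charged to the tail moment.\<close>

lemma (in prob_space) powr_moment_dist_le:
  fixes Y :: "'a \<Rightarrow> real"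
  assumes Y [measurable]: "Y \<in> borel_measurable M" and nonneg: "AE \<omega> in M. 0 \<le> Y \<omega>"
    and tail: "integrable M (\<lambda>\<omega>. indicator {real K<..} (Y \<omega>) * Y \<omega> ^ p)"
    and a: "0 < a" "a \<le> real K" and K: "1 \<le> K" and z: "0 \<le> Re z" "Re z \<le> real p"
    and near: "\<And>y. s\<^sub>1 < y \<Longrightarrow> y \<le> s\<^sub>2 \<Longrightarrow>
      norm (complex_of_real y powr z - complex_of_real a powr z) \<le> \<epsilon>"
    and \<epsilon>: "0 \<le> \<epsilon>"
  shows "norm ((\<integral>\<omega>. complex_of_real (Y \<omega>) powr z \<partial>M) - complex_of_real a powr z)
    \<le> \<epsilon> + 2 * real K powr Re z * (prob {\<omega> \<in> space M. Y \<omega> \<le> s\<^sub>1} + prob {\<omega> \<in> space M. s\<^sub>2 < Y \<omega>})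
      + (\<integral>\<omega>. indicator {real K<..} (Y \<omega>) * Y \<omega> ^ p \<partial>M)"
proof -
  let ?g = "\<lambda>y. complex_of_real y powr z" and ?B = "2 * real K powr Re z"
  let ?T = "\<lambda>\<omega>. indicator {real K<..} (Y \<omega>) * Y \<omega> ^ p"
  let ?lo = "{\<omega> \<in> space M. Y \<omega> \<le> s\<^sub>1}" and ?hi = "{\<omega> \<in> space M. s\<^sub>2 < Y \<omega>}"
  let ?h = "\<lambda>\<omega>. \<epsilon> + ?B * indicator ?lo \<omega> + ?B * indicator ?hi \<omega> + ?T \<omega>"
  have ga: "norm (?g a) \<le> real K powr Re z"
    using a z by (simp add: norm_powr_real_powr powr_mono2)
  have bound: "AE \<omega> in M. norm (?g (Y \<omega>) - ?g a) \<le> ?h \<omega>"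
    using nonneg AE_space
  proof eventually_elim
    case (elim \<omega>)
    have gY: "norm (?g (Y \<omega>)) = Y \<omega> powr Re z"
      using elim by (simp add: norm_powr_real_powr)
    have tri: "norm (?g (Y \<omega>) - ?g a) \<le> Y \<omega> powr Re z + real K powr Re z"
      using norm_triangle_ineq4[of "?g (Y \<omega>)" "?g a"] ga gY by linarith
    have T0: "0 \<le> ?T \<omega>" using elim by simp
    consider "s\<^sub>1 < Y \<omega>" "Y \<omega> \<le> s\<^sub>2" | "\<not> (s\<^sub>1 < Y \<omega> \<and> Y \<omega> \<le> s\<^sub>2)" by blast
    thus ?case
    proof cases
      case 1
      hence "?h \<omega> = \<epsilon> + ?T \<omega>" by simp
      thus ?thesis using near[OF 1] T0 by linarith
    next
      case 2
      hence "?B \<le> ?B * indicator ?lo \<omega> + ?B * indicator ?hi \<omega>"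
        using elim by (auto simp: indicator_def)
      moreover have "Y \<omega> powr Re z \<le> real K powr Re z + ?T \<omega>"
      proof (cases "real K < Y \<omega>")
        case True
        hence "Y \<omega> powr Re z \<le> Y \<omega> powr real p" using z K by (intro powr_mono) auto
        moreover have "Y \<omega> powr real p = ?T \<omega>" using True K by (simp add: powr_realpow)
        moreover have "0 \<le> real K powr Re z" by simp
        ultimately show ?thesis by linarith
      next
        case False
        hence "Y \<omega> powr Re z \<le> real K powr Re z" using elim z by (intro powr_mono2) auto
        thus ?thesis using T0 by linarith
      qed
      ultimately show ?thesis using tri \<epsilon> by linarith
    qed
  qed
  have inth: "integrable M ?h"
    by (intro Bochner_Integration.integrable_add integrable_mult_right integrable_real_indicator tail)
       (auto simp: emeasure_eq_measure)
  have meas: "(\<lambda>\<omega>. ?g (Y \<omega>)) \<in> borel_measurable M"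
    by (rule measurable_compose[OF Y]) measurable
  have intd: "integrable M (\<lambda>\<omega>. ?g (Y \<omega>) - ?g a)"
  proof (rule Bochner_Integration.integrable_bound[OF inth])
    show "AE \<omega> in M. norm (?g (Y \<omega>) - ?g a) \<le> norm (?h \<omega>)"
      using bound by eventually_elim auto
  qed (use meas in measurable)
  have intg: "integrable M (\<lambda>\<omega>. ?g (Y \<omega>))"
    using Bochner_Integration.integrable_add[OF intd integrable_const[of "?g a"]] by simp
  have "(\<integral>\<omega>. ?g (Y \<omega>) \<partial>M) - ?g a = (\<integral>\<omega>. ?g (Y \<omega>) - ?g a \<partial>M)"
    using intg by (simp add: prob_space)
  also have "norm \<dots> \<le> (\<integral>\<omega>. norm (?g (Y \<omega>) - ?g a) \<partial>M)" by (rule integral_norm_bound)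
  also have "\<dots> \<le> (\<integral>\<omega>. ?h \<omega> \<partial>M)"
    using bound by (intro integral_mono_AE integrable_norm intd inth)
  also have "\<dots> = \<epsilon> + ?B * prob ?lo + ?B * prob ?hi + (\<integral>\<omega>. ?T \<omega> \<partial>M)"
  proof -
    have 1: "integrable M (\<lambda>\<omega>. ?B * indicator ?lo \<omega>)" "integrable M (\<lambda>\<omega>. ?B * indicator ?hi \<omega>)"
      by (intro integrable_mult_right integrable_real_indicator; simp add: emeasure_eq_measure)+
    show ?thesis
      using 1 tail by (simp add: prob_space)
  qed
  finally show ?thesis by (simp add: algebra_simps)
qed

text \<open>Concentration at \<open>a\<close> from both sides, with the vanishing tail moment in the
  role of uniform integrability. The spaces vary with \<open>n\<close>, so convergence in
  probability is stated through their measures.\<close>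

lemma powr_moment_tendsto:
  fixes M :: "nat \<Rightarrow> 'a measure" and Y :: "nat \<Rightarrow> 'a \<Rightarrow> real"
  assumes M: "\<forall>\<^sub>F n in sequentially. prob_space (M n) \<and> Y n \<in> borel_measurable (M n) \<and>
      (AE \<omega> in M n. 0 \<le> Y n \<omega>) \<and> integrable (M n) (\<lambda>\<omega>. indicator {real K<..} (Y n \<omega>) * Y n \<omega> ^ p)"
    and a: "0 < a" "a \<le> real K" and K: "1 \<le> K" and z: "0 \<le> Re z" "Re z \<le> real p"
    and b: "b < a"
    and lo: "\<And>s. b < s \<Longrightarrow> s < a \<Longrightarrow> (\<lambda>n. measure (M n) {\<omega> \<in> space (M n). Y n \<omega> \<le> s}) \<longlonglongrightarrow> 0"
    and hi: "\<And>s. a < s \<Longrightarrow> (\<lambda>n. measure (M n) {\<omega> \<in> space (M n). s < Y n \<omega>}) \<longlonglongrightarrow> 0"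
    and tail: "(\<lambda>n. \<integral>\<omega>. indicator {real K<..} (Y n \<omega>) * Y n \<omega> ^ p \<partial>M n) \<longlonglongrightarrow> 0"
  shows "(\<lambda>n. \<integral>\<omega>. complex_of_real (Y n \<omega>) powr z \<partial>M n) \<longlonglongrightarrow> complex_of_real a powr z"
proof (rule tendstoI)
  fix e :: real assume e: "0 < e"
  obtain d where d: "0 < d" "\<And>y. \<bar>y - a\<bar> < d \<Longrightarrow>
      norm (complex_of_real y powr z - complex_of_real a powr z) < e / 2"
    using tendstoD[OF tendsto_of_real_powr[OF a(1), of z], of "e / 2"] e
    unfolding eventually_nhds_metric by (auto simp: dist_norm dist_real_def)
  \<comment> \<open>The midpoint keeps \<open>s\<^sub>1\<close> above \<open>b\<close>;
    \<open>d / 2\<close> keeps the window inside the \<open>d\<close>-neighbourhood of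
    \<open>a\<close>.\<close>
  define s\<^sub>1 where "s\<^sub>1 = max ((a + b) / 2) (a - d / 2)"
  define s\<^sub>2 where "s\<^sub>2 = a + d / 2"
  have s: "b < s\<^sub>1" "s\<^sub>1 < a" "a < s\<^sub>2" using b d by (auto simp: s\<^sub>1_def s\<^sub>2_def less_max_iff_disj)
  have near: "norm (complex_of_real y powr z - complex_of_real a powr z) \<le> e / 2"
    if "s\<^sub>1 < y" "y \<le> s\<^sub>2" for y
    by (rule less_imp_le, rule d(2)) (use that d(1) in \<open>auto simp: s\<^sub>1_def s\<^sub>2_def abs_if\<close>)
  let ?R = "\<lambda>n. e / 2 + 2 * real K powr Re z *
      (measure (M n) {\<omega> \<in> space (M n). Y n \<omega> \<le> s\<^sub>1} + measure (M n) {\<omega> \<in> space (M n). s\<^sub>2 < Y n \<omega>})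
      + (\<integral>\<omega>. indicator {real K<..} (Y n \<omega>) * Y n \<omega> ^ p \<partial>M n)"
  have "?R \<longlonglongrightarrow> e / 2 + 2 * real K powr Re z * (0 + 0) + 0"
    by (intro tendsto_intros lo hi tail s)
  hence "\<forall>\<^sub>F n in sequentially. ?R n < e" by (rule order_tendstoD(2)) (use e in simp)
  with M show "\<forall>\<^sub>F n in sequentially.
      dist (\<integral>\<omega>. complex_of_real (Y n \<omega>) powr z \<partial>M n) (complex_of_real a powr z) < e"
  proof eventually_elim
    case (elim n)
    then interpret prob_space "M n" by simp
    have "norm ((\<integral>\<omega>. complex_of_real (Y n \<omega>) powr z \<partial>M n) - complex_of_real a powr z) \<le> ?R n"
      by (rule powr_moment_dist_le) (use elim a K z near e in auto)
    thus ?case using elim by (simp add: dist_norm)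
  qed
qed

section \<open>Asymptotics of the Poisson probabilities\<close>

text \<open>Induction: passing from \<open>m\<close> to \<open>m + 1\<close> multiplies the right
  side by at least \<open>m + 1\<close>, because
  \<open>exp 1 \<le> ((m + 1) / m) ^ (m + 1)\<close>.\<close>

lemma fact_le_Stirling:
  assumes "1 \<le> m"
  shows "fact m \<le> exp 1 * real m * (real m / exp 1) ^ m"
  using assms
proof (induction m rule: dec_induct)
  case (step m)
  let ?x = "real m"
  have x: "1 \<le> ?x" using step by simp
  have "exp 1 \<le> ((?x + 1) / ?x) ^ (m + 1)"
  proof -
    have "1 - ?x / (?x + 1) \<le> - ln (?x / (?x + 1))"
      using ln_le_minus_one[of "?x / (?x + 1)"] x by simp
    also have "- ln (?x / (?x + 1)) = ln ((?x + 1) / ?x)"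
      using x by (simp add: ln_div)
    finally have "1 / (?x + 1) \<le> ln ((?x + 1) / ?x)" using x by (simp add: field_simps)
    hence "1 \<le> real (m + 1) * ln ((?x + 1) / ?x)" using x by (simp add: field_simps)
    hence "exp 1 \<le> exp (real (m + 1) * ln ((?x + 1) / ?x))" by simp
    also have "\<dots> = exp (ln ((?x + 1) / ?x)) ^ (m + 1)" by (rule exp_of_nat_mult)
    also have "exp (ln ((?x + 1) / ?x)) = (?x + 1) / ?x" using x by (intro exp_ln) auto
    finally show ?thesis .
  qed
  hence key: "exp 1 * ?x ^ (m + 1) \<le> (?x + 1) ^ (m + 1)"
    using x by (simp add: power_divide field_simps)
  have "fact (Suc m) \<le> (?x + 1) * (exp 1 * ?x * (?x / exp 1) ^ m)"
    using mult_left_mono[OF step.IH, of "?x + 1"] by (simp add: algebra_simps)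
  also have "\<dots> = (?x + 1) * (exp 1 * ?x ^ (m + 1)) / exp 1 ^ m"
    by (simp add: power_divide)
  also have "\<dots> \<le> (?x + 1) * (?x + 1) ^ (m + 1) / exp 1 ^ m"
    using key x by (intro divide_right_mono mult_left_mono) auto
  also have "\<dots> = exp 1 * real (Suc m) * (real (Suc m) / exp 1) ^ Suc m"
    by (simp add: power_divide add.commute)
  finally show ?case .
qed simp

text \<open>Only the last term \<open>k = m - 1\<close> of the sum is kept; it equals
  \<open>x ^ m / fact m * (m / x)\<close>, and the factorial is bounded by
  \<open>fact_le_Stirling\<close>.\<close>

lemma poisson_lt_lower:
  assumes "1 \<le> m" "0 < x"
  shows "exp (m - x) * (x / m) ^ m / (exp 1 * x) \<le> poisson_lt m x"
proof -
  have "(x / m) ^ m * exp m / (exp 1 * x) = x ^ m / (exp 1 * real m * (real m / exp 1) ^ m) * (m / x)"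
    using assms by (simp add: power_divide exp_of_nat_mult[of m 1, simplified] field_simps)
  also have "\<dots> \<le> x ^ m / fact m * (m / x)"
    using assms fact_le_Stirling[of m] by (intro mult_right_mono divide_left_mono) auto
  also have "\<dots> = x ^ (m - 1) / fact (m - 1)"
    using assms by (cases m) (auto simp del: of_nat_Suc)
  also have "\<dots> = (\<Sum>k\<in>{m - 1}. x ^ k / fact k)" by simp
  also have "\<dots> \<le> (\<Sum>k<m. x ^ k / fact k)"
    using assms by (intro sum_mono2) auto
  finally have "exp (- x) * ((x / m) ^ m * exp m / (exp 1 * x)) \<le> poisson_lt m x"
    unfolding poisson_lt_def by (intro mult_left_mono) auto
  thus ?thesis by (simp add: exp_diff exp_minus field_simps)
qed

text \<open>\<open>\<theta> = x / m\<close> minimises the Chernoff bound, and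
  \<open>m \<le> x\<close> makes it admissible.\<close>

lemma poisson_lt_upper:
  assumes "1 \<le> m" "real m \<le> x"
  shows "poisson_lt m x \<le> exp (m - x) * (x / m) ^ m"
  using poisson_lt_chernoff[of x "x / m" m] assms by (simp add: mult.commute)

definition phi :: "real \<Rightarrow> real \<Rightarrow> real" where
  "phi \<beta> s = s - \<beta> * ln s - (\<beta> - \<beta> * ln \<beta> + 1)"

text \<open>From \<open>\<beta>\<close> on the derivative \<open>1 - \<beta> / s\<close> is
  nonnegative; strictness comes from \<open>ln u < u - 1\<close> at
  \<open>u = y / x\<close>.\<close>

lemma phi_strict_mono:
  assumes "0 < \<beta>" "\<beta> \<le> x" "x < y"
  shows "phi \<beta> x < phi \<beta> y"
proof -
  have "ln y - ln x = ln (y / x)" using assms by (simp add: ln_div)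
  also have "\<dots> < y / x - 1" using assms ln_add_one_self_less_self[of "y / x - 1"] by simp
  finally have "\<beta> * (ln y - ln x) < \<beta> * (y / x - 1)" using assms by simp
  also have "\<dots> = (\<beta> / x) * (y - x)" using assms by (simp add: field_simps)
  also have "\<dots> \<le> 1 * (y - x)" using assms by (intro mult_right_mono) auto
  finally show ?thesis by (simp add: phi_def algebra_simps)
qed

text \<open>Since \<open>phi \<beta> \<beta> = -1\<close> and \<open>phi \<beta>\<close> tends to
  infinity, the intermediate value theorem gives a root; strict monotonicity makes it
  unique.\<close>

lemma phi_root:
  fixes \<beta> :: real
  assumes "0 < \<beta>"
  shows "\<exists>!a. a \<in> {\<beta><..} \<and> a - \<beta> * ln a = \<beta> - \<beta> * ln \<beta> + 1"
proof -
  have "filterlim (phi \<beta>) at_top at_top"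
    unfolding phi_def using assms by real_asymp
  hence "\<forall>\<^sub>F x in at_top. 0 \<le> phi \<beta> x \<and> \<beta> \<le> x"
    by (intro eventually_conj eventually_ge_at_top) (auto simp: filterlim_at_top)
  then obtain b where b: "0 \<le> phi \<beta> b" "\<beta> \<le> b"
    by (auto dest!: eventually_happens)
  have "\<exists>x\<ge>\<beta>. x \<le> b \<and> phi \<beta> x = 0"
    using assms b by (intro IVT') (auto simp: phi_def intro!: continuous_intros)
  then obtain a where a: "\<beta> \<le> a" "phi \<beta> a = 0" by blast
  have "a \<noteq> \<beta>" using a by (auto simp: phi_def)
  show ?thesis
  proof (rule ex1I[of _ a])
    show "a \<in> {\<beta><..} \<and> a - \<beta> * ln a = \<beta> - \<beta> * ln \<beta> + 1"
      using a \<open>a \<noteq> \<beta>\<close> by (auto simp: phi_def)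
    show "y = a" if "y \<in> {\<beta><..} \<and> y - \<beta> * ln y = \<beta> - \<beta> * ln \<beta> + 1" for y
      using phi_strict_mono[OF assms, of y a] phi_strict_mono[OF assms, of a y] that a
      by (fastforce simp: phi_def)
  qed
qed

lemma ln_real_at_top: "filterlim (\<lambda>n. ln (real n)) at_top sequentially"
  by real_asymp

section \<open>The critical scale \<open>t = s * n * ln n\<close>\<close>

context
  fixes m :: "nat \<Rightarrow> nat" and \<beta> :: real
  assumes m: "\<And>n. n \<ge> 1 \<Longrightarrow> m n \<ge> 1" and \<beta>: "0 < \<beta>"
    and lim: "(\<lambda>n. real (m n) / ln (real n)) \<longlonglongrightarrow> \<beta>"
begin

text \<open>With everything written as a power of \<open>exp L = n\<close>, the exponent divided by
  \<open>L\<close> depends on \<open>n\<close> only through the convergent ratio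
  \<open>m n / L\<close>.\<close>

lemma poisson_exponent:
  fixes L s :: real and n :: nat
  assumes n: "n \<ge> 2" and s: "0 < s" and L_def: "L = ln (real n)"
  shows "real n * (exp (m n - s * L) * (s * L / m n) ^ m n)
    = exp (L * (1 - s + m n / L * (1 + ln s - ln (m n / L))))"
proof -
  have L: "0 < L" using n by (simp add: L_def)
  have mp: "0 < real (m n)" using m[of n] n by linarith
  have "(s * L / m n) ^ m n = exp (real (m n) * ln (s * L / m n))"
    using s L mp by (subst exp_of_nat_mult) (simp add: exp_ln)
  also have "ln (s * L / m n) = ln s - ln (m n / L)"
    using s L mp by (simp add: ln_mult ln_div)
  finally have "(s * L / m n) ^ m n = exp (real (m n) * (ln s - ln (m n / L)))" .
  moreover have "real n = exp L" using n by (simp add: L_def)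
  ultimately have "real n * (exp (m n - s * L) * (s * L / m n) ^ m n)
      = exp (L + (m n - s * L + real (m n) * (ln s - ln (m n / L))))"
    by (simp only: exp_add)
  also have "L + (m n - s * L + real (m n) * (ln s - ln (m n / L)))
      = L * (1 - s + m n / L * (1 + ln s - ln (m n / L)))"
    using L by (simp add: field_simps)
  finally show ?thesis .
qed

lemma poisson_exponent_tendsto:
  assumes "0 < s"
  shows "(\<lambda>n. 1 - s + m n / ln (real n) * (1 + ln s - ln (m n / ln (real n)))) \<longlonglongrightarrow> - phi \<beta> s"
proof -
  have "(\<lambda>n. 1 - s + m n / ln (real n) * (1 + ln s - ln (m n / ln (real n))))
      \<longlonglongrightarrow> 1 - s + \<beta> * (1 + ln s - ln \<beta>)"
    using \<beta> by (intro tendsto_intros lim) auto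
  also have "1 - s + \<beta> * (1 + ln s - ln \<beta>) = - phi \<beta> s" by (simp add: phi_def algebra_simps)
  finally show ?thesis .
qed

text \<open>As \<open>\<beta> < s\<close>, eventually \<open>m n \<le> s * ln n\<close> and
  \<open>poisson_lt_upper\<close> applies. The resulting exponent is \<open>ln n\<close> times a
  sequence with the negative limit \<open>- phi \<beta> s\<close>.\<close>

lemma poisson_lt_above:
  assumes s: "\<beta> < s" and phi: "0 < phi \<beta> s"
  shows "(\<lambda>n. real n * poisson_lt (m n) (s * ln (real n))) \<longlonglongrightarrow> 0"
proof (rule tendsto_sandwich[of "\<lambda>_. 0"])
  let ?E = "\<lambda>n. ln (real n) * (1 - s + m n / ln (real n) * (1 + ln s - ln (m n / ln (real n))))"
  have s0: "0 < s" using s \<beta> by simp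
  have "filterlim ?E at_bot sequentially"
    using filterlim_tendsto_neg_mult_at_bot[OF poisson_exponent_tendsto[OF s0] _ ln_real_at_top] phi
    by (simp add: mult.commute)
  thus "(\<lambda>n. exp (?E n)) \<longlonglongrightarrow> 0" by (rule filterlim_compose[OF exp_at_bot])
  show "\<forall>\<^sub>F n in sequentially. real n * poisson_lt (m n) (s * ln (real n)) \<le> exp (?E n)"
    using order_tendstoD(2)[OF lim s] eventually_ge_at_top[of 2]
  proof eventually_elim
    case (elim n)
    have "0 < ln (real n)" using elim by simp
    hence "real (m n) \<le> s * ln (real n)" using elim by (simp add: field_simps)
    hence "real n * poisson_lt (m n) (s * ln (real n))
        \<le> real n * (exp (m n - s * ln n) * (s * ln n / m n) ^ m n)"
      using elim m[of n] by (intro mult_left_mono poisson_lt_upper) auto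
    thus ?case using elim by (simp only: poisson_exponent[OF _ s0 refl])
  qed
  show "\<forall>\<^sub>F n in sequentially. 0 \<le> real n * poisson_lt (m n) (s * ln (real n))"
    using eventually_ge_at_top[of 1]
    by eventually_elim (use s0 in \<open>auto intro!: mult_nonneg_nonneg poisson_lt_nonneg\<close>)
qed simp

text \<open>By \<open>1 - q \<le> exp (- q)\<close> it suffices that \<open>n * q\<close> tends to
  infinity, which follows from \<open>poisson_lt_lower\<close> as the exponent of \<open>n\<close>
  has a positive limit.\<close>

lemma poisson_lt_below:
  assumes s: "\<beta> < s" and phi: "phi \<beta> s < 0"
  shows "(\<lambda>n. (1 - poisson_lt (m n) (s * ln (real n))) ^ n) \<longlonglongrightarrow> 0"
proof (rule tendsto_sandwich[of "\<lambda>_. 0"])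
  let ?e = "\<lambda>n. 1 - s + m n / ln (real n) * (1 + ln s - ln (m n / ln (real n)))"
  \<comment> \<open>A value strictly between 0 and the limit exponent: it is eventually exceeded,
    and \<open>n\<close> to this power still beats the factor \<open>ln n\<close> lost in
    \<open>poisson_lt_lower\<close>.\<close>
  define c where "c = - phi \<beta> s / 2"
  have s0: "0 < s" using s \<beta> by simp
  have c: "0 < c" "c < - phi \<beta> s" using phi by (auto simp: c_def)
  show "(\<lambda>n. exp (- (exp (ln (real n) * c) / (exp 1 * (s * ln (real n)))))) \<longlonglongrightarrow> 0"
    using c s0 by real_asymp
  show "\<forall>\<^sub>F n in sequentially. (1 - poisson_lt (m n) (s * ln (real n))) ^ n
      \<le> exp (- (exp (ln (real n) * c) / (exp 1 * (s * ln (real n)))))"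
    using order_tendstoD(1)[OF poisson_exponent_tendsto[OF s0] c(2)] eventually_ge_at_top[of 2]
  proof eventually_elim
    case (elim n)
    let ?q = "poisson_lt (m n) (s * ln (real n))"
    have L: "0 < ln (real n)" using elim by simp
    have "exp (ln (real n) * c) / (exp 1 * (s * ln (real n)))
        \<le> exp (ln (real n) * ?e n) / (exp 1 * (s * ln (real n)))"
      using elim L s0 by (intro divide_right_mono) auto
    also have "\<dots> = real n * (exp (m n - s * ln n) * (s * ln n / m n) ^ m n / (exp 1 * (s * ln n)))"
      using elim poisson_exponent[OF _ s0 refl, of n] by simp
    also have "\<dots> \<le> real n * ?q"
      using L s0 elim m[of n] by (intro mult_left_mono poisson_lt_lower) auto
    finally have nq: "exp (ln (real n) * c) / (exp 1 * (s * ln (real n))) \<le> real n * ?q" .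
    have "0 \<le> 1 - ?q" using L s0 by (simp add: poisson_lt_le_1)
    moreover have "1 - ?q \<le> exp (- ?q)" using exp_ge_add_one_self[of "- ?q"] by simp
    ultimately have "(1 - ?q) ^ n \<le> exp (- ?q) ^ n" by (intro power_mono)
    also have "\<dots> = exp (- (real n * ?q))" by (simp add: exp_of_nat_mult[symmetric])
    also have "\<dots> \<le> exp (- (exp (ln (real n) * c) / (exp 1 * (s * ln (real n)))))"
      using nq by simp
    finally show ?case .
  qed
  show "\<forall>\<^sub>F n in sequentially. 0 \<le> (1 - poisson_lt (m n) (s * ln (real n))) ^ n"
    using eventually_ge_at_top[of 1]
    by eventually_elim (use s0 in \<open>auto intro!: zero_le_power simp: poisson_lt_le_1\<close>)
qed simp

text \<open>Eventually \<open>2 ^ m n\<close> is at most \<open>n\<close> to the power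
  \<open>\<beta> + 1\<close>, so up to the factor \<open>C\<close> the expression is at most
  \<open>n\<close> to the power \<open>\<beta> + 2 - K / 2\<close>. The bound on \<open>K\<close>
  makes this exponent at most -1.\<close>

lemma tail_const_tendsto:
  assumes K: "2 * (\<beta> + 3) \<le> real K"
  shows "(\<lambda>n. real n * 2 ^ m n * exp (- ln (real n) * real K / 2) * C) \<longlonglongrightarrow> 0"
proof -
  have "(\<lambda>n. real n * 2 ^ m n * exp (- ln (real n) * real K / 2)) \<longlonglongrightarrow> 0"
  proof (rule tendsto_sandwich[of "\<lambda>_. 0"])
    show "(\<lambda>n. exp (- ln (real n))) \<longlonglongrightarrow> 0" by real_asymp
    show "\<forall>\<^sub>F n in sequentially. real n * 2 ^ m n * exp (- ln (real n) * real K / 2) \<le> exp (- ln (real n))"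
      using order_tendstoD(2)[OF lim less_add_one] eventually_ge_at_top[of 2]
    proof eventually_elim
      case (elim n)
      let ?L = "ln (real n)"
      have L: "0 < ?L" using elim by simp
      have mL: "real (m n) \<le> (\<beta> + 1) * ?L" using elim L by (simp add: field_simps)
      have "(2::real) ^ m n \<le> exp 1 ^ m n" using exp_ge_add_one_self[of 1] by (intro power_mono) auto
      also have "\<dots> = exp (real (m n))" using exp_of_nat_mult[of "m n" "1 :: real"] by simp
      also have "\<dots> \<le> exp ((\<beta> + 1) * ?L)" using mL by simp
      finally have "real n * 2 ^ m n * exp (- ?L * real K / 2)
          \<le> real n * exp ((\<beta> + 1) * ?L) * exp (- ?L * real K / 2)"
        by (intro mult_right_mono mult_left_mono) auto
      also have "\<dots> = exp ?L * exp ((\<beta> + 1) * ?L) * exp (- ?L * real K / 2)" using elim by simp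
      also have "\<dots> = exp (?L + (\<beta> + 1) * ?L + - ?L * real K / 2)" by (simp only: exp_add)
      also have "\<dots> \<le> exp (- ?L)"
        using mult_left_mono[OF K, of ?L] L by (simp add: algebra_simps)
      finally show ?case .
    qed
  qed (auto intro!: always_eventually)
  thus ?thesis by (rule tendsto_mult_left_zero)
qed

end

lemma coupon_Delta_powr_moment_tendsto:
  fixes M :: "nat \<Rightarrow> 'a measure"
    and X :: "nat \<Rightarrow> nat \<Rightarrow> 'a \<Rightarrow> nat"
    and U :: "nat \<Rightarrow> nat \<Rightarrow> 'a \<Rightarrow> real"
    and m :: "nat \<Rightarrow> nat"
    and \<alpha> \<beta> :: real
  assumes coll: "\<And>n. n \<ge> 1 \<Longrightarrow> coupon_collector (M n) n (X n) (U n)"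
    and z: "Re z > 0" and \<beta>: "\<beta> > 0"
    and m: "\<And>n. n \<ge> 1 \<Longrightarrow> m n \<ge> 1"
    and lim: "(\<lambda>n. real (m n) / ln (real n)) \<longlonglongrightarrow> \<beta>"
    and \<alpha>: "\<beta> < \<alpha>" "phi \<beta> \<alpha> = 0"
  shows "(\<lambda>n. \<integral>\<omega>. complex_of_real (coupon_Delta (m n) n (X n) (U n) \<omega> / (real n * ln (real n))) powr z \<partial>M n)
    \<longlonglongrightarrow> complex_of_real \<alpha> powr z"
proof -
  define Y where "Y n \<omega> = coupon_Delta (m n) n (X n) (U n) \<omega> / (real n * ln (real n))" for n \<omega>
  define p where "p = nat \<lceil>Re z\<rceil>"
  \<comment> \<open>At least \<open>\<alpha>\<close> for \<open>powr_moment_tendsto\<close>, and at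
    least \<open>2 * (\<beta> + 3)\<close> for \<open>tail_const_tendsto\<close>.\<close>
  define K where "K = nat \<lceil>max \<alpha> (2 * (\<beta> + 3))\<rceil>"
  have p: "Re z \<le> real p" unfolding p_def by linarith
  have "max \<alpha> (2 * (\<beta> + 3)) \<le> real K" unfolding K_def by linarith
  hence K: "\<alpha> \<le> real K" "2 * (\<beta> + 3) \<le> real K" by auto
  have K1: "1 \<le> K"
  proof -
    have "2 * 3 \<le> 2 * (\<beta> + 3)" using \<beta> by simp
    also note K(2)
    finally show ?thesis by simp
  qed
  \<comment> \<open>The tail estimates are applied with \<open>L = ln n\<close> and ask for
    \<open>2 \<le> L\<close>.\<close>
  have large: "\<forall>\<^sub>F n in sequentially. 1 \<le> n \<and> 2 \<le> ln (real n)"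
    using ln_real_at_top by (intro eventually_conj eventually_ge_at_top) (simp add: filterlim_at_top)
  have "(\<lambda>n. \<integral>\<omega>. complex_of_real (Y n \<omega>) powr z \<partial>M n) \<longlonglongrightarrow> complex_of_real \<alpha> powr z"
  proof (rule powr_moment_tendsto)
    show "\<forall>\<^sub>F n in sequentially. prob_space (M n) \<and> Y n \<in> borel_measurable (M n) \<and>
      (AE \<omega> in M n. 0 \<le> Y n \<omega>) \<and> integrable (M n) (\<lambda>\<omega>. indicator {real K<..} (Y n \<omega>) * Y n \<omega> ^ p)"
      using large
    proof eventually_elim
      case (elim n)
      interpret coupon_collector "M n" n "X n" "U n" using coll elim by simp
      have mn: "1 \<le> m n" using m elim by simp
      note [measurable] = measurable_coupon_Delta_XU[OF mn]
      have "Y n \<in> borel_measurable (M n)" unfolding Y_def by measurable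
      moreover have "AE \<omega> in M n. 0 \<le> Y n \<omega>"
        using AE_coupon_Delta[OF mn] by eventually_elim (use elim in \<open>simp add: Y_def\<close>)
      moreover have "integrable (M n) (\<lambda>\<omega>. indicator {real K<..} (Y n \<omega>) * Y n \<omega> ^ p)"
        unfolding Y_def using integrable_coupon_Delta_tail[OF mn, of "ln (real n)" K p] elim by simp
      ultimately show ?case using prob_space_axioms by blast
    qed
    show "(\<lambda>n. \<integral>\<omega>. indicator {real K<..} (Y n \<omega>) * Y n \<omega> ^ p \<partial>M n) \<longlonglongrightarrow> 0"
    proof (rule tendsto_sandwich[of "\<lambda>_. 0"])
      show "\<forall>\<^sub>F n in sequentially. 0 \<le> (\<integral>\<omega>. indicator {real K<..} (Y n \<omega>) * Y n \<omega> ^ p \<partial>M n)"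
        by (intro always_eventually allI integral_nonneg_AE AE_I2) (auto simp: indicator_def)
      show "\<forall>\<^sub>F n in sequentially. (\<integral>\<omega>. indicator {real K<..} (Y n \<omega>) * Y n \<omega> ^ p \<partial>M n)
          \<le> real n * 2 ^ m n * exp (- ln (real n) * real K / 2) * tail_moment_const p K"
        using large
      proof eventually_elim
        case (elim n)
        interpret coupon_collector "M n" n "X n" "U n" using coll elim by simp
        show ?case unfolding Y_def using m elim by (intro coupon_Delta_tail_le) auto
      qed
      show "(\<lambda>n. real n * 2 ^ m n * exp (- ln (real n) * real K / 2) * tail_moment_const p K) \<longlonglongrightarrow> 0"
        by (rule tail_const_tendsto[OF m \<beta> lim K(2)])
    qed simp
    \<comment> \<open>The lower limit \<open>b\<close> of \<open>powr_moment_tendsto\<close> is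
      \<open>\<beta>\<close>, from where on \<open>phi \<beta>\<close> increases.\<close>
    fix s assume s: "\<beta> < s" "s < \<alpha>"
    have "phi \<beta> s < 0" using phi_strict_mono[OF \<beta>, of s \<alpha>] s \<alpha> by simp
    hence "(\<lambda>n. (1 - poisson_lt (m n) (s * ln (real n))) ^ n) \<longlonglongrightarrow> 0"
      using s by (intro poisson_lt_below[OF m \<beta> lim]) auto
    moreover have "\<forall>\<^sub>F n in sequentially. (1 - poisson_lt (m n) (s * ln (real n))) ^ n
        = measure (M n) {\<omega> \<in> space (M n). Y n \<omega> \<le> s}"
      using large
    proof eventually_elim
      case (elim n)
      interpret coupon_collector "M n" n "X n" "U n" using coll elim by simp
      \<comment> \<open>Chosen such that \<open>?t / n\<close> is \<open>s * ln n\<close>.\<close>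
      let ?t = "s * ln (real n) * real n"
      have nL: "0 < real n * ln (real n)"
        using conjunct1[OF elim] conjunct2[OF elim] by (intro mult_pos_pos) linarith+
      have "{\<omega> \<in> space (M n). Y n \<omega> \<le> s} = {\<omega> \<in> space (M n). coupon_Delta (m n) n (X n) (U n) \<omega> \<le> ?t}"
        unfolding Y_def pos_divide_le_eq[OF nL] by (simp add: mult_ac)
      moreover have "0 \<le> ?t" using elim s \<beta> by simp
      ultimately show ?case using prob_coupon_Delta_le[OF m, of n ?t] elim by simp
    qed
    ultimately show "(\<lambda>n. measure (M n) {\<omega> \<in> space (M n). Y n \<omega> \<le> s}) \<longlonglongrightarrow> 0"
      by (rule Lim_transform_eventually)
  next
    fix s assume s: "\<alpha> < s"
    have "0 < phi \<beta> s" using phi_strict_mono[OF \<beta>, of \<alpha> s] s \<alpha> by simp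
    hence upper: "(\<lambda>n. real n * poisson_lt (m n) (s * ln (real n))) \<longlonglongrightarrow> 0"
      using s \<alpha> by (intro poisson_lt_above[OF m \<beta> lim]) auto
    show "(\<lambda>n. measure (M n) {\<omega> \<in> space (M n). s < Y n \<omega>}) \<longlonglongrightarrow> 0"
    proof (rule tendsto_sandwich[OF _ _ tendsto_const upper])
      show "\<forall>\<^sub>F n in sequentially. measure (M n) {\<omega> \<in> space (M n). s < Y n \<omega>}
          \<le> real n * poisson_lt (m n) (s * ln (real n))"
        using large
      proof eventually_elim
        case (elim n)
        interpret coupon_collector "M n" n "X n" "U n" using coll elim by simp
        let ?t = "s * ln (real n) * real n"
        have nL: "0 < real n * ln (real n)"
        using conjunct1[OF elim] conjunct2[OF elim] by (intro mult_pos_pos) linarith+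
        have "{\<omega> \<in> space (M n). s < Y n \<omega>} = {\<omega> \<in> space (M n). ?t < coupon_Delta (m n) n (X n) (U n) \<omega>}"
          unfolding Y_def pos_less_divide_eq[OF nL] by (simp add: mult_ac)
        moreover have "0 \<le> ?t" using elim s \<alpha> \<beta> by simp
        ultimately show ?case using prob_coupon_Delta_gt[OF m, of n ?t] elim by simp
      qed
    qed simp
  qed (use \<alpha> \<beta> K K1 z p in auto)
  thus ?thesis by (simp add: Y_def)
qed

theorem theorem2:
  fixes M :: "nat \<Rightarrow> 'a measure"
    and X :: "nat \<Rightarrow> nat \<Rightarrow> 'a \<Rightarrow> nat"
    and U :: "nat \<Rightarrow> nat \<Rightarrow> 'a \<Rightarrow> real"
    and m :: "nat \<Rightarrow> nat"
    and z :: complex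
    and \<alpha> \<beta> :: real
  assumes "\<And>n. n \<ge> 1 \<Longrightarrow> coupon_collector (M n) n (X n) (U n)"
    and "Re z > 0"
    and "\<beta> > 0"
    and "\<And>n. n \<ge> 1 \<Longrightarrow> m n \<ge> 1"
    and "(\<lambda>n. real (m n)) \<sim>[sequentially] (\<lambda>n. \<beta> * ln (real n))"
    and "\<alpha> = (THE a. a \<in> {\<beta><..} \<and> a - \<beta> * ln a = \<beta> - \<beta> * ln \<beta> + 1)"
  shows "(\<exists>!a. a \<in> {\<beta><..} \<and> a - \<beta> * ln a = \<beta> - \<beta> * ln \<beta> + 1) \<and>
    (\<forall>n\<ge>1.
       integrable (M n) (\<lambda>\<omega>. Gamma (of_nat (coupon_D (m n) n (X n) \<omega>) + z)
                              / fact (coupon_D (m n) n (X n) \<omega> - 1)) \<and>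
       integrable (M n) (\<lambda>\<omega>. complex_of_real (coupon_Delta (m n) n (X n) (U n) \<omega>) powr z) \<and>
       integral\<^sup>L (M n) (\<lambda>\<omega>. Gamma (of_nat (coupon_D (m n) n (X n) \<omega>) + z)
                              / fact (coupon_D (m n) n (X n) \<omega> - 1))
       = integral\<^sup>L (M n) (\<lambda>\<omega>. complex_of_real (coupon_Delta (m n) n (X n) (U n) \<omega>) powr z)) \<and>
    (\<lambda>n. integral\<^sup>L (M n) (\<lambda>\<omega>. complex_of_real (coupon_Delta (m n) n (X n) (U n) \<omega>) powr z))
      \<sim>[sequentially]
    (\<lambda>n. complex_of_real \<alpha> powr z * of_nat n powr z * complex_of_real (ln (real n)) powr z) \<and>
    (\<lambda>n. complex_of_real \<alpha> powr z * of_nat n powr z * complex_of_real (ln (real n)) powr z)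
      \<sim>[sequentially]
    (\<lambda>n. complex_of_real (\<alpha> / \<beta>) powr z * of_nat n powr z * of_nat (m n) powr z)"
proof -
  let ?L = "\<lambda>n. ln (real n)"
  let ?Delta = "\<lambda>n. coupon_Delta (m n) n (X n) (U n)"
  note z = assms(2) and \<beta> = assms(3) and m = assms(4)
  have root: "\<exists>!a. a \<in> {\<beta><..} \<and> a - \<beta> * ln a = \<beta> - \<beta> * ln \<beta> + 1" by (rule phi_root[OF \<beta>])
  have "\<alpha> \<in> {\<beta><..} \<and> \<alpha> - \<beta> * ln \<alpha> = \<beta> - \<beta> * ln \<beta> + 1"
    unfolding assms(6) by (rule theI'[OF root])
  hence \<alpha>: "\<beta> < \<alpha>" "phi \<beta> \<alpha> = 0" by (auto simp: phi_def)
  \<comment> \<open>Asymptotic equivalence sets the ratio to 1 where both sides vanish; from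
    \<open>n = 2\<close> on \<open>\<beta> * ln n\<close> is nonzero and the plain quotient
    remains.\<close>
  have ratio: "(\<lambda>n. real (m n) / (\<beta> * ?L n)) \<longlonglongrightarrow> 1"
  proof (rule Lim_transform_eventually[OF assms(5)[unfolded asymp_equiv_def]])
    show "\<forall>\<^sub>F n in sequentially. (if real (m n) = 0 \<and> \<beta> * ?L n = 0 then 1
        else real (m n) / (\<beta> * ?L n)) = real (m n) / (\<beta> * ?L n)"
      using eventually_ge_at_top[of 2] by eventually_elim (use \<beta> in simp)
  qed
  hence "(\<lambda>n. \<beta> * (real (m n) / (\<beta> * ?L n))) \<longlonglongrightarrow> \<beta> * 1" by (rule tendsto_mult_left)
  hence lim: "(\<lambda>n. real (m n) / ?L n) \<longlonglongrightarrow> \<beta>" using \<beta> by simp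
  have \<alpha>z: "complex_of_real \<alpha> powr z \<noteq> 0" using \<alpha> \<beta> by simp
  have moments: "integrable (M n) (\<lambda>\<omega>. Gamma (of_nat (coupon_D (m n) n (X n) \<omega>) + z)
        / fact (coupon_D (m n) n (X n) \<omega> - 1)) \<and>
      integrable (M n) (\<lambda>\<omega>. complex_of_real (?Delta n \<omega>) powr z) \<and>
      integral\<^sup>L (M n) (\<lambda>\<omega>. Gamma (of_nat (coupon_D (m n) n (X n) \<omega>) + z)
        / fact (coupon_D (m n) n (X n) \<omega> - 1))
      = integral\<^sup>L (M n) (\<lambda>\<omega>. complex_of_real (?Delta n \<omega>) powr z)" if "n \<ge> 1" for n
  proof -
    interpret coupon_collector "M n" n "X n" "U n" by (rule assms(1)[OF that])
    show ?thesis
      using coupon_D_moment[OF m[OF that] z] integrable_coupon_Delta_powr[OF m[OF that] z] by simp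
  qed
  have "(\<lambda>n. integral\<^sup>L (M n) (\<lambda>\<omega>. complex_of_real (?Delta n \<omega>) powr z))
      \<sim>[sequentially]
    (\<lambda>n. complex_of_real \<alpha> powr z * of_nat n powr z * complex_of_real (?L n) powr z)"
  proof (rule asymp_equivI')
    have "(\<lambda>n. (\<integral>\<omega>. complex_of_real (?Delta n \<omega> / (real n * ?L n)) powr z \<partial>M n) / complex_of_real \<alpha> powr z)
        \<longlonglongrightarrow> complex_of_real \<alpha> powr z / complex_of_real \<alpha> powr z"
      using \<alpha>z by (intro tendsto_divide tendsto_const
        coupon_Delta_powr_moment_tendsto[OF assms(1) z \<beta> m lim \<alpha>])
    moreover have "\<forall>\<^sub>F n in sequentially.
        (\<integral>\<omega>. complex_of_real (?Delta n \<omega> / (real n * ?L n)) powr z \<partial>M n) / complex_of_real \<alpha> powr z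
        = integral\<^sup>L (M n) (\<lambda>\<omega>. complex_of_real (?Delta n \<omega>) powr z)
          / (complex_of_real \<alpha> powr z * of_nat n powr z * complex_of_real (?L n) powr z)"
      using eventually_ge_at_top[of 2]
    proof eventually_elim
      case (elim n)
      let ?c = "of_nat n powr z * complex_of_real (?L n) powr z"
      have nL: "0 < real n * ?L n" using elim by simp
      have c: "complex_of_real (real n * ?L n) powr z = ?c"
        using elim by (simp add: powr_times_real_left)
      \<comment> \<open>Complex powers of products need not split. Here the left factor is a
        positive real, which suffices for every value of \<open>?Delta n \<omega>\<close>, also on
        null paths.\<close>
      have "complex_of_real (?Delta n \<omega>) powr z
          = ?c * complex_of_real (?Delta n \<omega> / (real n * ?L n)) powr z" for \<omega>
      proof -
        have "x = c * (x / c)" if "0 < c" for x c :: real using that by simp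
        from this[OF nL] have "complex_of_real (?Delta n \<omega>)
            = complex_of_real (real n * ?L n) * complex_of_real (?Delta n \<omega> / (real n * ?L n))"
          by (subst of_real_mult[symmetric]) (rule arg_cong)
        also have "\<dots> powr z = ?c * complex_of_real (?Delta n \<omega> / (real n * ?L n)) powr z"
          unfolding c[symmetric] using nL by (intro powr_times_real_left) auto
        finally show ?thesis .
      qed
      moreover have "?c \<noteq> 0" using elim by simp
      ultimately show ?case by (simp add: field_simps)
    qed
    ultimately show "(\<lambda>n. integral\<^sup>L (M n) (\<lambda>\<omega>. complex_of_real (?Delta n \<omega>) powr z)
        / (complex_of_real \<alpha> powr z * of_nat n powr z * complex_of_real (?L n) powr z)) \<longlonglongrightarrow> 1"
      using \<alpha>z by (simp add: Lim_transform_eventually)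
  qed
  moreover have "(\<lambda>n. complex_of_real \<alpha> powr z * of_nat n powr z * complex_of_real (?L n) powr z)
      \<sim>[sequentially]
    (\<lambda>n. complex_of_real (\<alpha> / \<beta>) powr z * of_nat n powr z * of_nat (m n) powr z)"
  proof (rule asymp_equivI')
    have "(\<lambda>n. inverse (real (m n) / (\<beta> * ?L n))) \<longlonglongrightarrow> inverse 1"
      by (intro tendsto_inverse ratio) simp
    hence "(\<lambda>n. complex_of_real (inverse (real (m n) / (\<beta> * ?L n))) powr z) \<longlonglongrightarrow> complex_of_real 1 powr z"
      by (intro filterlim_compose[OF tendsto_of_real_powr]) auto
    moreover have "\<forall>\<^sub>F n in sequentially. complex_of_real (inverse (real (m n) / (\<beta> * ?L n))) powr z
        = (complex_of_real \<alpha> powr z * of_nat n powr z * complex_of_real (?L n) powr z)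
          / (complex_of_real (\<alpha> / \<beta>) powr z * of_nat n powr z * of_nat (m n) powr z)"
      using eventually_ge_at_top[of 2]
    proof eventually_elim
      case (elim n)
      \<comment> \<open>\<open>?r\<close> tends to 1, hence so does its power; it is the factor by
        which \<open>\<alpha> * ln n\<close> differs from
        \<open>(\<alpha> / \<beta>) * m n\<close>.\<close>
      let ?r = "inverse (real (m n) / (\<beta> * ?L n))"
      have mn: "0 < real (m n)" using m[of n] elim by linarith
      have L: "0 < ?L n" using elim by simp
      have "complex_of_real \<alpha> powr z * complex_of_real (?L n) powr z = complex_of_real (\<alpha> * ?L n) powr z"
        using \<alpha> \<beta> by (simp add: powr_times_real_left)
      also have "\<alpha> * ?L n = (\<alpha> / \<beta>) * (real (m n) * ?r)" using mn L \<beta> by (simp add: field_simps)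
      also have "complex_of_real \<dots> powr z
          = complex_of_real (\<alpha> / \<beta>) powr z * (of_nat (m n) powr z * complex_of_real ?r powr z)"
      proof -
        have "complex_of_real ((\<alpha> / \<beta>) * (real (m n) * ?r)) powr z
            = (complex_of_real (\<alpha> / \<beta>) * complex_of_real (real (m n) * ?r)) powr z" by simp
        also have "\<dots> = complex_of_real (\<alpha> / \<beta>) powr z * complex_of_real (real (m n) * ?r) powr z"
          using \<alpha> \<beta> by (intro powr_times_real_left) auto
        also have "complex_of_real (real (m n) * ?r) powr z = (of_nat (m n) * complex_of_real ?r) powr z"
          by simp
        also have "\<dots> = of_nat (m n) powr z * complex_of_real ?r powr z"
          by (intro powr_times_real_left) auto
        finally show ?thesis .
      qed
      finally have "complex_of_real \<alpha> powr z * complex_of_real (?L n) powr z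
          = complex_of_real (\<alpha> / \<beta>) powr z * (of_nat (m n) powr z * complex_of_real ?r powr z)" .
      moreover have "complex_of_real (\<alpha> / \<beta>) powr z \<noteq> 0" "of_nat (m n) powr z \<noteq> 0" "of_nat n powr z \<noteq> 0"
        using \<alpha> \<beta> mn elim by auto
      ultimately show ?case by (simp add: divide_simps mult_ac)
    qed
    ultimately show "(\<lambda>n. (complex_of_real \<alpha> powr z * of_nat n powr z * complex_of_real (?L n) powr z)
        / (complex_of_real (\<alpha> / \<beta>) powr z * of_nat n powr z * of_nat (m n) powr z)) \<longlonglongrightarrow> 1"
      by (simp add: Lim_transform_eventually)
  qed
  ultimately show ?thesis using root moments by blast
qed

end
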